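(* Let $n,m\ge 1$ be integers. (1) For every pair of non-negative integers $(p,q)$ with $p+q=nm$, the space $H(C(S^1)^{(n)},m)_{p,q}$ of non-singular hermitian block Toeplitz matrices with signature $(p,q)$ is path-connected. (2) The space $H(C(S^1)^{(n)},m)$ of non-singular hermitian block Toeplitz matrices has $nm+1$ path-connected components, which are labeled by matrix signatures. Consequently, the signature induces a bijection $\mathcal V_0(C(S^1)^{(n)},m)\cong\{-nm,-nm+2,\ldots,nm\}$.
   Context: $C(S^1)^{(n)}\subseteq M_n(\mathbb C)$ is the operator system of $n\times n$ Toeplitz matrices $(t_{i-j})_{i,j=1}^n$, $t_k\in\mathbb C$. The space $M_m(C(S^1)^{(n)})$ is identified with the space of $nm\times nm$ block Toeplitz matrices $T=(T_{i-j})_{i,j=1}^n$ with blocks $T_k\in M_m(\mathbb C)$, $-n+1\le k\le n-1$. $H(C(S^1)^{(n)},m)$ is the set of those $T\in M_m(C(S^1)^{(n)})$ that are hermitian ($T=T^*$) and invertible as $nm\times nm$ matrices, with the topology inherited from $M_{nm}(\mathbb C)$. $H(C(S^1)^{(n)},m)_{p,q}$ is the subset of matrices with exactly $p$ positive and $q$ negative eigenvalues (with multiplicity), i.e. of signature $(p,q)$. $\mathcal V_0(C(S^1)^{(n)},m):=\pi_0(H(C(S^1)^{(n)},m))$ is its set of path components; the integer label of signature $(p,q)$ is $p-q$. *)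

theory Defs
  imports
    "HOL-Analysis.Analysis"
    "Jordan_Normal_Form.Schur_Decomposition"
begin

text \<open>
  The sizes are natural numbers, so matrices are taken from the entry
  \<open>Jordan_Normal_Form\<close>, whose matrix type carries no topology. The usual topology of
  $M_N(\mathbb{C}) \cong \mathbb{C}^{N \times N}$ is pulled back along the entry map.
\<close>

definition mat_topology :: "nat \<Rightarrow> complex mat topology" where
  "mat_topology N =
     pullback_topology (carrier_mat N N)
       (\<lambda>A. restrict (\<lambda>ij. A $$ ij) ({0..<N} \<times> {0..<N}))
       (product_topology (\<lambda>_. euclidean) ({0..<N} \<times> {0..<N}))"

lemma topspace_mat_topology: "topspace (mat_topology N) = carrier_mat N N"
  by (auto simp: mat_topology_def topspace_pullback_topology)

definition hermitian_mat :: "complex mat \<Rightarrow> bool" where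
  "hermitian_mat A \<longleftrightarrow> square_mat A \<and> mat_adjoint A = A"

text \<open>
  Multiplicities are algebraic. Only real eigenvalues are counted, which is no restriction
  for hermitian matrices.
\<close>

definition num_pos_eigenvalues :: "complex mat \<Rightarrow> nat" where
  "num_pos_eigenvalues A =
     (\<Sum>z | eigenvalue A z \<and> z \<in> \<real> \<and> Re z > 0. Polynomial.order z (char_poly A))"

definition num_neg_eigenvalues :: "complex mat \<Rightarrow> nat" where
  "num_neg_eigenvalues A =
     (\<Sum>z | eigenvalue A z \<and> z \<in> \<real> \<and> Re z < 0. Polynomial.order z (char_poly A))"

definition signature_label :: "complex mat \<Rightarrow> int" where
  "signature_label A = int (num_pos_eigenvalues A) - int (num_neg_eigenvalues A)"

text \<open>
  $T = (T_{i-j})$ with $m \times m$ blocks, flattened to an $nm \times nm$ matrix: row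
  \<open>r\<close> lies in block row \<open>r div m\<close> at position \<open>r mod m\<close>, and likewise for columns.
\<close>

definition block_toeplitz_mat :: "nat \<Rightarrow> nat \<Rightarrow> (int \<Rightarrow> complex mat) \<Rightarrow> complex mat" where
  "block_toeplitz_mat n m T =
     mat (n * m) (n * m)
       (\<lambda>(r, c). T (int (r div m) - int (c div m)) $$ (r mod m, c mod m))"

text \<open>The space $M_m(C(S^1)^{(n)})$.\<close>

definition block_toeplitz :: "nat \<Rightarrow> nat \<Rightarrow> complex mat set" where
  "block_toeplitz n m =
     {block_toeplitz_mat n m T | T. \<forall>k \<in> {- int n + 1 .. int n - 1}. T k \<in> carrier_mat m m}"

text \<open>$H(C(S^1)^{(n)}, m)$, its subsets $H(C(S^1)^{(n)}, m)_{p,q}$, and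
  $\mathcal{V}_0(C(S^1)^{(n)}, m)$.\<close>

definition H_toeplitz :: "nat \<Rightarrow> nat \<Rightarrow> complex mat set" where
  "H_toeplitz n m = {T \<in> block_toeplitz n m. hermitian_mat T \<and> invertible_mat T}"

definition H_toeplitz_sig :: "nat \<Rightarrow> nat \<Rightarrow> nat \<Rightarrow> nat \<Rightarrow> complex mat set" where
  "H_toeplitz_sig n m p q =
     {T \<in> H_toeplitz n m. num_pos_eigenvalues T = p \<and> num_neg_eigenvalues T = q}"

definition V0_toeplitz :: "nat \<Rightarrow> nat \<Rightarrow> complex mat set set" where
  "V0_toeplitz n m = path_components_of (subtopology (mat_topology (n * m)) (H_toeplitz n m))"

end

theory Submission
  imports Defs "Jordan_Normal_Form.Spectral_Radius"
begin

text \<open>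
  Along a path of nonsingular hermitian matrices the signature is constant, so the content is that the
  nonsingular hermitian block Toeplitz matrices of one fixed signature form a nonempty path-connected
  set.

  The argument takes leading minors, but in a basis in which they move independently of each other.
  Regard a block Toeplitz matrix as a hermitian form on polynomials of degree \<open>< n\<close> with
  coefficients in \<open>\<complex>\<^sup>m\<close>, and use the flag of polynomials \<open>z\<^sup>j (z - 1)\<^bsup>n-1-j\<^esup>\<close>
  (\<open>flag_poly\<close>), tensored with the standard basis of \<open>\<complex>\<^sup>m\<close>. The Toeplitz form
  with symbol \<open>k \<mapsto> (\<i> k)\<^sup>s\<close> is differentiation of order \<open>s\<close> at \<open>z = 1\<close>,
  so it vanishes on pairs of polynomials whose orders of vanishing at \<open>1\<close> add up to more than
  \<open>s\<close> (\<open>symbol_form_zero\<close>), and does not vanish when they add up to exactly \<open>s\<close>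
  (\<open>symbol_form_leading_nonzero\<close>). Hence, writing \<open>G\<^sub>k(T)\<close> for the leading
  \<open>k \<times> k\<close> Gram matrix of \<open>T\<close> along the flag (indices from 0), the space contains for every
  \<open>k\<close> a form that changes \<open>G\<^sub>k\<^sub>+\<^sub>1\<close> only in its last diagonal entry
  (\<open>toeplitz_corner\<close>), and a form that changes the entries \<open>(k, k+1)\<close> and
  \<open>(k+1, k)\<close> of \<open>G\<^sub>k\<^sub>+\<^sub>2\<close> without touching \<open>G\<^sub>k\<^sub>+\<^sub>1\<close>
  or the rest of the last column above the diagonal (\<open>toeplitz_off_corner\<close>).

  For any real space \<open>L\<close> of hermitian forms with these two kinds of elements (locale
  \<open>flagged_hermitian_space\<close>) induction on \<open>k\<close> shows that the set \<open>S k p q\<close> of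
  those \<open>T \<in> L\<close> for which \<open>G\<^sub>k(T)\<close> is nonsingular of signature \<open>(p, q)\<close>
  is path-connected (\<open>S_joined\<close>). A small perturbation makes \<open>G\<^sub>k(T)\<close> nonsingular
  for a given \<open>T \<in> S (k+1) p q\<close>; then the sign of
  \<open>det G\<^sub>k\<^sub>+\<^sub>1(T) / det G\<^sub>k(T)\<close> decides whether \<open>T\<close> lies in
  \<open>S k (p-1) q\<close> or in \<open>S k p (q-1)\<close> (\<open>bordered_inertia\<close>). Two elements of
  the same kind are joined by a path in the smaller stratum, lifted by adding a large multiple of the
  corner form (\<open>joined_same_sign\<close>). To pass from one kind to the other it is enough to find one
  path doing so: take \<open>T\<close> with \<open>det G\<^sub>k\<^sub>-\<^sub>1(T) \<noteq> 0\<close>,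
  \<open>det G\<^sub>k(T) = 0\<close> and \<open>det G\<^sub>k\<^sub>+\<^sub>1(T) \<noteq> 0\<close>, and move
  \<open>T\<close> a little in both directions along the corner form of \<open>G\<^sub>k\<close>
  (\<open>sign_swap\<close>).

  For \<open>k = n m\<close> the Gram matrix is congruent to \<open>T\<close> itself, so its signature is that of
  \<open>T\<close> (\<open>has_inertia_congruence\<close>).
\<close>

unbundle no vec_syntax

section \<open>Adjoints and unitary diagonalization\<close>

lemma mat_adjoint_carrier: "A \<in> carrier_mat n m \<Longrightarrow> mat_adjoint A \<in> carrier_mat m n"
  by (auto simp: mat_adjoint_def)

lemma mat_adjoint_index:
  "A \<in> carrier_mat n m \<Longrightarrow> i < m \<Longrightarrow> j < n \<Longrightarrow> mat_adjoint A $$ (i,j) = cnj (A $$ (j,i))"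
  by (auto simp: mat_adjoint_def mat_of_rows_def)

lemma mat_adjoint_mult:
  fixes A B :: "complex mat"
  assumes A: "A \<in> carrier_mat n m" and B: "B \<in> carrier_mat m l"
  shows "mat_adjoint (A * B) = mat_adjoint B * mat_adjoint A"
proof (rule eq_matI)
  have AB: "A * B \<in> carrier_mat n l" using A B by simp
  have d: "mat_adjoint B * mat_adjoint A \<in> carrier_mat l n"
    using mat_adjoint_carrier[OF A] mat_adjoint_carrier[OF B] by simp
  show "dim_row (mat_adjoint (A * B)) = dim_row (mat_adjoint B * mat_adjoint A)"
    "dim_col (mat_adjoint (A * B)) = dim_col (mat_adjoint B * mat_adjoint A)"
    using mat_adjoint_carrier[OF AB] d by auto
  fix i j assume "i < dim_row (mat_adjoint B * mat_adjoint A)" "j < dim_col (mat_adjoint B * mat_adjoint A)"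
  then have i: "i < l" and j: "j < n" using d by auto
  have "mat_adjoint (A * B) $$ (i,j) = cnj (\<Sum>k<m. A $$ (j,k) * B $$ (k,i))"
    using mat_adjoint_index[OF AB i j] A B i j by (simp add: scalar_prod_def atLeast0LessThan)
  also have "\<dots> = (\<Sum>k<m. mat_adjoint B $$ (i,k) * mat_adjoint A $$ (k,j))"
    using mat_adjoint_index[OF A _ j] mat_adjoint_index[OF B i] by (simp add: mult.commute)
  also have "\<dots> = (mat_adjoint B * mat_adjoint A) $$ (i,j)"
    using mat_adjoint_carrier[OF A] mat_adjoint_carrier[OF B] i j
    by (simp add: scalar_prod_def atLeast0LessThan)
  finally show "mat_adjoint (A * B) $$ (i,j) = (mat_adjoint B * mat_adjoint A) $$ (i,j)" .
qed

lemma mat_adjoint_adjoint: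
  fixes A :: "complex mat"
  assumes A: "A \<in> carrier_mat n m"
  shows "mat_adjoint (mat_adjoint A) = A"
  using A mat_adjoint_carrier[OF A] mat_adjoint_carrier[OF mat_adjoint_carrier[OF A]]
  by (intro eq_matI) (auto simp: mat_adjoint_index[OF mat_adjoint_carrier[OF A]] mat_adjoint_index[OF A])

text \<open>
  Gram-Schmidt applied to a basis that starts with \<open>v\<close>, followed by normalization of the columns.
\<close>

lemma unitary_with_first_column:
  fixes v :: "complex vec"
  assumes v: "v \<in> carrier_vec n" and v0: "v \<noteq> 0\<^sub>v n" and n: "0 < n"
  obtains W c where "W \<in> carrier_mat n n" "mat_adjoint W * W = 1\<^sub>m n" "col W 0 = c \<cdot>\<^sub>v v"
proof -
  interpret cof_vec_space n "TYPE(complex)" .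
  define b where "b = basis_completion v"
  define ws where "ws = gram_schmidt n b"
  from basis_completion[OF v v0, folded b_def]
  have b: "distinct b" "\<not> lin_dep (set b)" "set b \<subseteq> carrier_vec n" "hd b = v" "length b = n"
    by auto
  from b(4,5) n obtain vs where bv: "b = v # vs" by (cases b) auto
  from gram_schmidt_result[OF b(3,1,2) refl, folded ws_def] b(5)
  have ws: "set ws \<subseteq> carrier_vec n" "corthogonal ws" "length ws = n" by auto
  from gram_schmidt_hd[OF v, of vs, folded bv] have hdws: "hd ws = v" unfolding ws_def .
  have wsi: "ws ! i \<in> carrier_vec n" if "i < n" for i using ws that by auto
  define c where "c i = complex_of_real (1 / sqrt (Re (ws ! i \<bullet>c ws ! i)))" for i
  define W where "W = mat n n (\<lambda>(r,i). c i * (ws ! i) $ r)"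
  have W: "W \<in> carrier_mat n n" by (simp add: W_def)
  have "mat_adjoint W * W = 1\<^sub>m n"
  proof (rule eq_matI)
    fix i j assume "i < dim_row (1\<^sub>m n :: complex mat)" "j < dim_col (1\<^sub>m n :: complex mat)"
    then have ij: "i < n" "j < n" by auto
    have sp: "ws ! j \<bullet>c ws ! i = (\<Sum>r<n. (ws ! j) $ r * cnj ((ws ! i) $ r))"
      using wsi[OF ij(1)] wsi[OF ij(2)] by (simp add: scalar_prod_def atLeast0LessThan)
    have "(mat_adjoint W * W) $$ (i,j) = (\<Sum>r<n. cnj (W $$ (r,i)) * W $$ (r,j))"
      using ij W mat_adjoint_carrier[OF W]
      by (simp add: scalar_prod_def atLeast0LessThan mat_adjoint_index[OF W])
    also have "\<dots> = c i * c j * (ws ! j \<bullet>c ws ! i)"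
      using ij by (simp add: W_def sp sum_distrib_left sum_divide_distrib c_def algebra_simps)
    also have "\<dots> = (if i = j then 1 else 0)"
    proof (cases "i = j")
      case True
      have "ws ! i \<bullet>c ws ! i \<noteq> 0" using corthogonalD[OF ws(2)] ij ws(3) by auto
      moreover have e: "ws ! i \<bullet>c ws ! i = complex_of_real (\<Sum>r<n. (cmod ((ws ! i) $ r))\<^sup>2)"
        unfolding sp[unfolded True[symmetric]] by (simp only: of_real_sum complex_norm_square)
      ultimately have "(\<Sum>r<n. (cmod ((ws ! i) $ r))\<^sup>2) > 0"
        by (metis (no_types, lifting) less_eq_real_def of_real_0 sum_nonneg zero_le_power2)
      moreover define x where "x = (\<Sum>r<n. (cmod ((ws ! i) $ r))\<^sup>2)"
      ultimately have x: "x > 0" by simp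
      have "c i * c i * complex_of_real x = complex_of_real ((1 / sqrt x) * (1 / sqrt x) * x)"
        by (simp only: c_def e x_def Re_complex_of_real of_real_mult)
      also have "\<dots> = 1" using x by (simp add: field_simps)
      finally show ?thesis using True e x_def by simp
    next
      case False
      then show ?thesis using corthogonalD[OF ws(2)] ij ws(3) by auto
    qed
    finally show "(mat_adjoint W * W) $$ (i,j) = (1\<^sub>m n :: complex mat) $$ (i,j)"
      using ij by simp
  qed (use W mat_adjoint_carrier[OF W] in auto)
  moreover have "col W 0 = c 0 \<cdot>\<^sub>v v"
  proof -
    have "ws ! 0 = v" using hdws ws(3) n by (cases ws) auto
    then show ?thesis using n v by (intro eq_vecI) (auto simp: W_def)
  qed
  ultimately show ?thesis using that W by blast
qed

definition real_diag_mat :: "nat \<Rightarrow> (nat \<Rightarrow> real) \<Rightarrow> complex mat" where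
  "real_diag_mat n d = mat n n (\<lambda>(i,j). if i = j then complex_of_real (d i) else 0)"

lemma hermitian_index:
  assumes "A \<in> carrier_mat n n" "mat_adjoint A = A" "i < n" "j < n"
  shows "cnj (A $$ (j,i)) = A $$ (i,j)"
  using mat_adjoint_index[OF assms(1,3,4)] assms(2) by simp

lemma hermitianI:
  fixes A :: "complex mat"
  assumes "A \<in> carrier_mat n n" "\<And>i j. i < n \<Longrightarrow> j < n \<Longrightarrow> cnj (A $$ (j,i)) = A $$ (i,j)"
  shows "mat_adjoint A = A"
  using assms mat_adjoint_carrier[OF assms(1)]
  by (intro eq_matI) (auto simp: mat_adjoint_index[OF assms(1)])

text \<open>
  Induction on the size: conjugation by a unitary matrix whose first column is an eigenvector splits off
  a \<open>1 \<times> 1\<close> block, because the conjugate is again hermitian.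
\<close>

theorem hermitian_unitarily_diagonalizable:
  assumes "A \<in> carrier_mat n n" "mat_adjoint A = A"
  shows "\<exists>U d. U \<in> carrier_mat n n \<and> mat_adjoint U * U = 1\<^sub>m n \<and> A * U = U * real_diag_mat n d"
  using assms
proof (induction n arbitrary: A)
  case 0
  then show ?case
    by (intro exI[of _ "1\<^sub>m 0"] exI[of _ "\<lambda>_. 0"]) (auto simp: mat_adjoint_def real_diag_mat_def)
next
  case (Suc m)
  let ?n = "Suc m"
  note A = Suc.prems(1) and herm = Suc.prems(2)
  obtain e where e: "eigenvalue A e"
    using spectrum_non_empty[OF A] by (auto simp: spectrum_def)
  then obtain v where v: "v \<in> carrier_vec ?n" "v \<noteq> 0\<^sub>v ?n" "A *\<^sub>v v = e \<cdot>\<^sub>v v"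
    using A by (auto simp: eigenvalue_def eigenvector_def)
  obtain W c where W: "W \<in> carrier_mat ?n ?n" and un: "mat_adjoint W * W = 1\<^sub>m ?n"
    and c: "col W 0 = c \<cdot>\<^sub>v v"
    using unitary_with_first_column[OF v(1,2)] by blast
  have W': "mat_adjoint W \<in> carrier_mat ?n ?n" using mat_adjoint_carrier[OF W] .
  have un': "W * mat_adjoint W = 1\<^sub>m ?n"
    using mat_mult_left_right_inverse[OF W' W un] .
  define B where "B = mat_adjoint W * A * W"
  have B: "B \<in> carrier_mat ?n ?n" using W W' A by (simp add: B_def)
  have hB: "mat_adjoint B = B"
  proof -
    have "mat_adjoint B = mat_adjoint W * mat_adjoint (mat_adjoint W * A)"
      unfolding B_def by (rule mat_adjoint_mult[OF mult_carrier_mat[OF W' A] W])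
    also have "mat_adjoint (mat_adjoint W * A) = A * W"
      using mat_adjoint_mult[OF W' A] herm mat_adjoint_adjoint[OF W] by simp
    finally show ?thesis using W W' A by (simp add: B_def assoc_mult_mat[OF W' A W])
  qed
  have col0: "B $$ (i,0) = (if i = 0 then e else 0)" if i: "i < ?n" for i
  proof -
    have Wc: "col W 0 \<in> carrier_vec ?n" using col_carrier_vec[OF _ W, of 0] by simp
    have "col B 0 = (mat_adjoint W * A) *\<^sub>v col W 0"
      unfolding B_def using W by (intro col_mult2[of _ ?n ?n]) (use W W' A in auto)
    also have "\<dots> = mat_adjoint W *\<^sub>v (A *\<^sub>v col W 0)"
      using assoc_mult_mat_vec[OF W' A Wc] .
    also have "A *\<^sub>v col W 0 = e \<cdot>\<^sub>v col W 0"
      unfolding c using v A by (auto simp: mult_mat_vec smult_smult_assoc mult.commute)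
    also have "mat_adjoint W *\<^sub>v (e \<cdot>\<^sub>v col W 0) = e \<cdot>\<^sub>v col (mat_adjoint W * W) 0"
      using W by (simp only: mult_mat_vec[OF W' Wc] col_mult2[OF W' W zero_less_Suc])
    finally have "col B 0 $ i = (e \<cdot>\<^sub>v col (1\<^sub>m ?n) 0) $ i" unfolding un by simp
    then show ?thesis using i B by simp
  qed
  have row0: "B $$ (0,i) = 0" if "0 < i" "i < ?n" for i
    using hermitian_index[OF B hB, of 0 i] col0[of i] that by simp
  have er: "cnj e = e" using hermitian_index[OF B hB, of 0 0] col0[of 0] by simp
  define A3 where "A3 = mat m m (\<lambda>(i,j). B $$ (Suc i, Suc j))"
  have A3: "A3 \<in> carrier_mat m m" by (simp add: A3_def)
  have hA3: "mat_adjoint A3 = A3"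
    by (rule hermitianI[OF A3]) (simp add: A3_def hermitian_index[OF B hB])
  from Suc.IH[OF A3 hA3] obtain U3 d3 where U3: "U3 \<in> carrier_mat m m"
    "mat_adjoint U3 * U3 = 1\<^sub>m m" "A3 * U3 = U3 * real_diag_mat m d3" by blast
  have U3': "mat_adjoint U3 \<in> carrier_mat m m" using mat_adjoint_carrier[OF U3(1)] .
  define d where "d i = (case i of 0 \<Rightarrow> Re e | Suc j \<Rightarrow> d3 j)" for i
  let ?E = "mat 1 1 (\<lambda>_. e)"
  define V where "V = four_block_mat (1\<^sub>m 1) (0\<^sub>m 1 m) (0\<^sub>m m 1) U3"
  have V: "V \<in> carrier_mat ?n ?n" using U3 by (auto simp: V_def)
  have Vi: "V $$ (i,j) = (if i = 0 \<or> j = 0 then (if i = j then 1 else 0) else U3 $$ (i - 1, j - 1))"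
    if "i < ?n" "j < ?n" for i j
    using that U3(1) by (auto simp: V_def)
  have V': "mat_adjoint V = four_block_mat (1\<^sub>m 1) (0\<^sub>m 1 m) (0\<^sub>m m 1) (mat_adjoint U3)"
    using V mat_adjoint_carrier[OF V] U3' U3(1)
    by (intro eq_matI) (auto simp: mat_adjoint_index[OF V] Vi mat_adjoint_index[OF U3(1)])
  have Bb: "B = four_block_mat ?E (0\<^sub>m 1 m) (0\<^sub>m m 1) A3"
    using B col0 row0 by (intro eq_matI) (auto simp: A3_def)
  have Db: "real_diag_mat ?n d = four_block_mat ?E (0\<^sub>m 1 m) (0\<^sub>m m 1) (real_diag_mat m d3)"
    using er by (intro eq_matI) (auto simp: real_diag_mat_def d_def complex_eq_iff split: nat.splits)
  have one: "four_block_mat (1\<^sub>m 1) (0\<^sub>m 1 m) (0\<^sub>m m 1) (1\<^sub>m m) = (1\<^sub>m ?n :: complex mat)"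
    by (intro eq_matI) auto
  have D3: "real_diag_mat m d3 \<in> carrier_mat m m" by (simp add: real_diag_mat_def)
  have VV: "mat_adjoint V * V = 1\<^sub>m ?n"
    unfolding V' unfolding V_def
    by (subst mult_four_block_mat[where ?nr1.0 = 1 and ?n1.0 = 1 and ?nr2.0 = m and ?n2.0 = m])
       (use U3 U3' one in auto)
  have BV: "B * V = V * real_diag_mat ?n d"
    unfolding Bb Db unfolding V_def
    by (subst (1 2) mult_four_block_mat[where ?nr1.0 = 1 and ?n1.0 = 1 and ?nr2.0 = m and ?n2.0 = m])
       (use U3 A3 D3 in \<open>auto\<close>)
  have D: "real_diag_mat ?n d \<in> carrier_mat ?n ?n" by (simp add: real_diag_mat_def)
  have V'c: "mat_adjoint V \<in> carrier_mat ?n ?n" using mat_adjoint_carrier[OF V] .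
  have "W * B = W * (mat_adjoint W * (A * W))"
    unfolding B_def by (simp only: assoc_mult_mat[OF W' A W])
  also have "\<dots> = A * W"
    using A W by (simp only: assoc_mult_mat[OF W W' mult_carrier_mat[OF A W], symmetric] un') simp
  finally have AW: "W * B = A * W" .
  have "mat_adjoint (W * V) * (W * V) = mat_adjoint V * (mat_adjoint W * (W * V))"
    by (simp only: mat_adjoint_mult[OF W V] assoc_mult_mat[OF V'c W' mult_carrier_mat[OF W V]])
  also have "mat_adjoint W * (W * V) = V"
    using V by (simp only: assoc_mult_mat[OF W' W V, symmetric] un) simp
  finally have "mat_adjoint (W * V) * (W * V) = 1\<^sub>m ?n" unfolding VV .
  moreover have "A * (W * V) = (W * V) * real_diag_mat ?n d"
  proof -
    have "A * (W * V) = W * (B * V)"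
      by (simp only: assoc_mult_mat[OF A W V, symmetric] AW[symmetric] assoc_mult_mat[OF W B V])
    also have "\<dots> = (W * V) * real_diag_mat ?n d"
      by (simp only: BV assoc_mult_mat[OF W V D])
    finally show ?thesis .
  qed
  ultimately show ?case using W V by (intro exI[of _ "W * V"] exI[of _ d]) auto
qed

section \<open>Hermitian forms and the law of inertia\<close>

definition qform :: "nat \<Rightarrow> complex mat \<Rightarrow> (nat \<Rightarrow> complex) \<Rightarrow> complex" where
  "qform n A v = (\<Sum>r<n. \<Sum>s<n. cnj (v r) * A $$ (r,s) * v s)"

text \<open>
  The Gram matrix of the first \<open>k\<close> columns of \<open>C\<close> under the form \<open>A\<close>. Written as a double
  sum rather than a matrix product, it needs no truncation of \<open>C\<close>, and each entry is visibly linear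
  and continuous in \<open>A\<close>.
\<close>

definition gram :: "nat \<Rightarrow> complex mat \<Rightarrow> nat \<Rightarrow> complex mat \<Rightarrow> complex mat" where
  "gram n C k A = mat k k (\<lambda>(i,j). \<Sum>r<n. \<Sum>s<n. cnj (C $$ (r,i)) * A $$ (r,s) * C $$ (s,j))"

lemma gram_carrier [simp]: "gram n C k A \<in> carrier_mat k k"
  and dim_gram [simp]: "dim_row (gram n C k A) = k" "dim_col (gram n C k A) = k"
  by (auto simp: gram_def)

lemma gram_index:
  "i < k \<Longrightarrow> j < k \<Longrightarrow>
     gram n C k A $$ (i,j) = (\<Sum>r<n. \<Sum>s<n. cnj (C $$ (r,i)) * A $$ (r,s) * C $$ (s,j))"
  by (simp add: gram_def)

lemma gram_hermitian:
  assumes A: "A \<in> carrier_mat n n" "mat_adjoint A = A"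
  shows "mat_adjoint (gram n C k A) = gram n C k A"
proof (rule hermitianI[OF gram_carrier])
  fix i j assume ij: "i < k" "j < k"
  have "cnj (gram n C k A $$ (j,i)) = (\<Sum>r<n. \<Sum>s<n. C $$ (r,j) * cnj (A $$ (r,s)) * cnj (C $$ (s,i)))"
    using ij by (simp add: gram_index)
  also have "\<dots> = (\<Sum>r<n. \<Sum>s<n. cnj (C $$ (s,i)) * A $$ (s,r) * C $$ (r,j))"
    using hermitian_index[OF A] by (intro sum.cong refl) (simp add: mult_ac)
  also have "\<dots> = gram n C k A $$ (i,j)"
    using ij by (subst sum.swap) (simp add: gram_index)
  finally show "cnj (gram n C k A $$ (j,i)) = gram n C k A $$ (i,j)" .
qed

lemma qform_gram:
  "qform k (gram n C k A) c = qform n A (\<lambda>r. \<Sum>i<k. C $$ (r,i) * c i)"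
proof -
  have "qform n A (\<lambda>r. \<Sum>i<k. C $$ (r,i) * c i)
      = (\<Sum>r<n. \<Sum>s<n. \<Sum>i<k. \<Sum>j<k. cnj (c i) * (cnj (C $$ (r,i)) * A $$ (r,s) * C $$ (s,j)) * c j)"
    unfolding qform_def
    by (intro sum.cong refl) (simp add: sum_distrib_left sum_distrib_right mult_ac)
  also have "\<dots> = (\<Sum>i<k. \<Sum>j<k. \<Sum>r<n. \<Sum>s<n. cnj (c i) * (cnj (C $$ (r,i)) * A $$ (r,s) * C $$ (s,j)) * c j)"
    by (subst (2) sum.swap, subst sum.swap, subst (3) sum.swap, subst (2) sum.swap) simp
  also have "\<dots> = qform k (gram n C k A) c"
    unfolding qform_def
    by (intro sum.cong refl) (simp add: gram_index sum_distrib_left sum_distrib_right mult_ac)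
  finally show ?thesis ..
qed

lemma qform_real_diag:
  "qform n (real_diag_mat n d) c = of_real (\<Sum>k<n. d k * (cmod (c k))\<^sup>2)"
proof -
  have "qform n (real_diag_mat n d) c
     = (\<Sum>r<n. \<Sum>s<n. if s = r then of_real (d r * (cmod (c r))\<^sup>2) else 0)"
    unfolding qform_def
    by (intro sum.cong refl)
       (auto simp: real_diag_mat_def complex_norm_square[unfolded of_real_power] mult_ac)
  then show ?thesis by simp
qed

text \<open>
  A homogeneous linear system with more unknowns than equations has a nonzero solution. The unknowns are
  indexed by an arbitrary finite set, so that the lemma applies to vectors supported on a set of
  coordinates. One equation is eliminated at each induction step.
\<close>

lemma exists_supported_solution:
  fixes w :: "'a \<Rightarrow> 'b \<Rightarrow> 'c :: field"
  assumes "finite J" "finite I" "card J < card I"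
  shows "\<exists>c. (\<exists>i\<in>I. c i \<noteq> 0) \<and> (\<forall>i. i \<notin> I \<longrightarrow> c i = 0) \<and> (\<forall>k\<in>J. (\<Sum>i\<in>I. w k i * c i) = 0)"
  using assms
proof (induction J arbitrary: I w rule: finite_induct)
  case empty
  then obtain i where "i \<in> I" by (metis card.empty equals0I less_irrefl)
  then show ?case by (intro exI[of _ "\<lambda>j. if j = i then 1 else 0"]) auto
next
  case (insert k J)
  show ?case
  proof (cases "\<forall>i\<in>I. w k i = 0")
    case True
    have "card J < card I" using insert.prems insert.hyps by simp
    then obtain c where "\<exists>i\<in>I. c i \<noteq> 0" "\<forall>i. i \<notin> I \<longrightarrow> c i = 0"
      "\<forall>l\<in>J. (\<Sum>i\<in>I. w l i * c i) = 0"
      using insert.IH[of I w] insert.prems by auto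
    then show ?thesis using True by (intro exI[of _ c]) auto
  next
    case False
    then obtain a where a: "a \<in> I" "w k a \<noteq> 0" by auto
    define w' where "w' l i = w l i - w l a * w k i / w k a" for l i
    have "card J < card (I - {a})" using insert a by simp
    then obtain c where c: "\<exists>i\<in>I - {a}. c i \<noteq> 0" "\<forall>i. i \<notin> I - {a} \<longrightarrow> c i = 0"
      "\<forall>l\<in>J. (\<Sum>i\<in>I - {a}. w' l i * c i) = 0"
      using insert.IH[of "I - {a}" w'] insert.prems by auto
    define t where "t = - (\<Sum>i\<in>I - {a}. w k i * c i) / w k a"
    define c' where "c' = c(a := t)"
    have s: "(\<Sum>i\<in>I. w l i * c' i) = w l a * t + (\<Sum>i\<in>I - {a}. w l i * c i)" for l
      using a insert.prems by (subst sum.remove[of I a]) (auto simp: c'_def intro!: sum.cong)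
    have "(\<Sum>i\<in>I. w l i * c' i) = 0" if l: "l \<in> J" for l
    proof -
      have "(\<Sum>i\<in>I - {a}. w' l i * c i)
          = (\<Sum>i\<in>I - {a}. w l i * c i) - w l a / w k a * (\<Sum>i\<in>I - {a}. w k i * c i)"
        by (simp add: w'_def algebra_simps sum_subtractf sum_distrib_left)
      then show ?thesis using c(3) l by (simp add: s t_def)
    qed
    moreover have "(\<Sum>i\<in>I. w k i * c' i) = 0" using a by (simp add: s t_def)
    moreover have "\<exists>i\<in>I. c' i \<noteq> 0" using c(1) by (auto simp: c'_def)
    moreover have "\<forall>i. i \<notin> I \<longrightarrow> c' i = 0" using c(2) a by (auto simp: c'_def)
    ultimately show ?thesis by (intro exI[of _ c']) auto
  qed
qed

lemma order_prod_linear: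
  fixes a :: "nat \<Rightarrow> complex"
  shows "Polynomial.order z (\<Prod>k<n. [:- a k, 1:]) = card {k. k < n \<and> a k = z}"
proof (induction n)
  case (Suc n)
  have nz: "(\<Prod>k<n. [:- a k, 1:]) * [:- a n, 1:] \<noteq> 0" unfolding mult_eq_0_iff by simp
  have l: "Polynomial.order z [:- a n, 1:] = (if a n = z then 1 else 0)"
    using count_proots[of "[:- a n, 1:]" z] by auto
  have "{k. k < Suc n \<and> a k = z} = (if a n = z then insert n {k. k < n \<and> a k = z} else {k. k < n \<and> a k = z})"
    by (auto simp: less_Suc_eq)
  then show ?case using Suc order_mult[OF nz, of z] l by auto
qed auto

lemma sum_fibre_cards:
  fixes d :: "nat \<Rightarrow> real"
  shows "(\<Sum>z | (\<exists>k<n. z = complex_of_real (d k)) \<and> z \<in> \<real> \<and> R (Re z). card {k. k < n \<and> complex_of_real (d k) = z})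
    = card {k. k < n \<and> R (d k)}"
proof -
  let ?Z = "{z. (\<exists>k<n. z = complex_of_real (d k)) \<and> z \<in> \<real> \<and> R (Re z)}"
  have Z: "?Z = (\<lambda>k. complex_of_real (d k)) ` {k. k < n \<and> R (d k)}" by auto
  have "card {k. k < n \<and> R (d k)} = card (\<Union>z\<in>?Z. {k. k < n \<and> complex_of_real (d k) = z})"
    by (rule arg_cong[of _ _ card]) auto
  also have "\<dots> = (\<Sum>z\<in>?Z. card {k. k < n \<and> complex_of_real (d k) = z})"
    by (rule card_UN_disjoint) (unfold Z, auto)
  finally show ?thesis by simp
qed

text \<open>
  Unitary diagonalization in the form used from here on: signature, determinant and quadratic form are all
  read off from the same real eigenvalues \<open>d\<close>.
\<close>

lemma hermitian_inertia:
  assumes A: "A \<in> carrier_mat n n" "mat_adjoint A = A"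
  obtains U d where "U \<in> carrier_mat n n" "mat_adjoint U * U = 1\<^sub>m n"
    "gram n U n A = real_diag_mat n d" "det A = (\<Prod>k<n. complex_of_real (d k))"
    "num_pos_eigenvalues A = card {k. k < n \<and> d k > 0}"
    "num_neg_eigenvalues A = card {k. k < n \<and> d k < 0}"
    "\<And>v. qform n A v = of_real (\<Sum>k<n. d k * (cmod (\<Sum>j<n. cnj (U $$ (j,k)) * v j))\<^sup>2)"
proof -
  obtain U d where U: "U \<in> carrier_mat n n" "mat_adjoint U * U = 1\<^sub>m n" "A * U = U * real_diag_mat n d"
    using hermitian_unitarily_diagonalizable[OF A] by blast
  have U': "mat_adjoint U \<in> carrier_mat n n" using mat_adjoint_carrier[OF U(1)] .
  have UU': "U * mat_adjoint U = 1\<^sub>m n" using mat_mult_left_right_inverse[OF U' U(1,2)] .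
  have D: "real_diag_mat n d \<in> carrier_mat n n" by (simp add: real_diag_mat_def)
  have gr: "gram n U n A = mat_adjoint U * (A * U)"
    using U' U(1) A
    by (intro eq_matI)
       (auto simp: gram_index scalar_prod_def atLeast0LessThan mat_adjoint_index[OF U(1)] sum_distrib_left mult_ac)
  then have gr': "gram n U n A = real_diag_mat n d"
    using U U' D by (simp flip: assoc_mult_mat[OF U' U(1) D])
  have "A = U * real_diag_mat n d * mat_adjoint U"
    unfolding U(3)[symmetric] using A(1) by (simp add: assoc_mult_mat[OF A(1) U(1) U'] UU')
  then have "similar_mat_wit A (real_diag_mat n d) U (mat_adjoint U)"
    using A U UU' U' D unfolding similar_mat_wit_def Let_def by auto
  then have sim: "similar_mat A (real_diag_mat n d)" unfolding similar_mat_def by blast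
  have "char_poly A = char_poly (real_diag_mat n d)" using char_poly_similar[OF sim] .
  also have "\<dots> = (\<Prod>a\<leftarrow>diag_mat (real_diag_mat n d). [:- a, 1:])"
    by (rule char_poly_upper_triangular[OF D]) (auto simp: real_diag_mat_def)
  also have "diag_mat (real_diag_mat n d) = map (\<lambda>k. complex_of_real (d k)) [0..<n]"
    by (auto simp: diag_mat_def real_diag_mat_def intro!: map_cong)
  finally have cp: "char_poly A = (\<Prod>k<n. [:- complex_of_real (d k), 1:])"
    by (simp add: o_def lessThan_atLeast0 flip: prod.distinct_set_conv_list)
  have "det A = det (real_diag_mat n d)" using det_similar[OF sim] .
  also have "\<dots> = prod_list (diag_mat (real_diag_mat n d))"
    by (rule det_upper_triangular[OF _ D]) (auto simp: real_diag_mat_def)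
  also have "diag_mat (real_diag_mat n d) = map (\<lambda>k. complex_of_real (d k)) [0..<n]"
    by (auto simp: diag_mat_def real_diag_mat_def intro!: map_cong)
  finally have dt: "det A = (\<Prod>k<n. complex_of_real (d k))"
    by (simp add: lessThan_atLeast0 flip: prod.distinct_set_conv_list)
  have ev: "eigenvalue A z \<longleftrightarrow> (\<exists>k<n. z = complex_of_real (d k))" for z
    unfolding eigenvalue_root_char_poly[OF A(1)] cp by (auto simp: poly_prod)
  have np: "num_pos_eigenvalues A = card {k. k < n \<and> d k > 0}"
    unfolding num_pos_eigenvalues_def ev cp order_prod_linear by (rule sum_fibre_cards)
  have nn: "num_neg_eigenvalues A = card {k. k < n \<and> d k < 0}"
    unfolding num_neg_eigenvalues_def ev cp order_prod_linear by (rule sum_fibre_cards)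
  have q: "qform n A v = of_real (\<Sum>k<n. d k * (cmod (\<Sum>j<n. cnj (U $$ (j,k)) * v j))\<^sup>2)" for v
  proof -
    let ?c = "\<lambda>k. \<Sum>j<n. cnj (U $$ (j,k)) * v j"
    have "(\<Sum>k<n. U $$ (r,k) * ?c k) = v r" if r: "r < n" for r
    proof -
      have "(\<Sum>k<n. U $$ (r,k) * ?c k) = (\<Sum>j<n. (\<Sum>k<n. U $$ (r,k) * cnj (U $$ (j,k))) * v j)"
        by (simp add: sum_distrib_left sum_distrib_right mult_ac) (rule sum.swap)
      also have "\<dots> = (\<Sum>j<n. (U * mat_adjoint U) $$ (r,j) * v j)"
        using r U(1) U' by (intro sum.cong refl)
          (simp add: scalar_prod_def atLeast0LessThan mat_adjoint_index[OF U(1)])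
      also have "\<dots> = (\<Sum>j<n. if j = r then v r else 0)"
        unfolding UU' using r by (intro sum.cong refl) auto
      finally show ?thesis using r by simp
    qed
    then have "qform n A v = qform n A (\<lambda>r. \<Sum>k<n. U $$ (r,k) * ?c k)"
      unfolding qform_def by (intro sum.cong refl) simp
    also have "\<dots> = qform n (real_diag_mat n d) ?c" unfolding qform_gram[symmetric] gr' ..
    finally show ?thesis unfolding qform_real_diag .
  qed
  show ?thesis by (rule that[OF U(1,2) gr' dt np nn q])
qed

text \<open>
  The dimension count behind the law of inertia. If \<open>\<sigma>\<close> times the form is positive on a space
  of dimension \<open>card I\<close>, and fewer than \<open>card I\<close> of the \<open>\<sigma> * d k\<close> were positive, then some
  nonzero vector of that space would be annihilated by all the corresponding linear functionals
  \<open>w k\<close>, and \<open>\<sigma>\<close> times the form would be nonpositive on it.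
\<close>

lemma definite_index_bound:
  assumes q: "\<And>v. qform n A v = of_real (\<Sum>k<n. d k * (cmod (\<Sum>j<n. w k j * v j))\<^sup>2)"
    and I: "I \<subseteq> {..<m}"
    and def: "\<And>c. \<exists>i\<in>I. c i \<noteq> 0 \<Longrightarrow> (\<And>i. i \<notin> I \<Longrightarrow> c i = 0) \<Longrightarrow> \<sigma> * Re (qform m (gram n P m A) c) > 0"
  shows "card I \<le> card {k. k < n \<and> \<sigma> * d k > 0}"
proof (rule ccontr)
  let ?J = "{k. k < n \<and> \<sigma> * d k > 0}"
  assume "\<not> ?thesis"
  moreover have fI: "finite I" using I finite_subset by blast
  ultimately obtain c where c: "\<exists>i\<in>I. c i \<noteq> 0" "\<forall>i. i \<notin> I \<longrightarrow> c i = 0"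
    "\<forall>k\<in>?J. (\<Sum>i\<in>I. (\<Sum>j<n. w k j * P $$ (j,i)) * c i) = 0"
    using exists_supported_solution[of ?J I "\<lambda>k i. \<Sum>j<n. w k j * P $$ (j,i)"] by auto
  define v where "v j = (\<Sum>i<m. P $$ (j,i) * c i)" for j
  have z: "(\<Sum>j<n. w k j * v j) = 0" if "k \<in> ?J" for k
  proof -
    have "(\<Sum>j<n. w k j * v j) = (\<Sum>i<m. (\<Sum>j<n. w k j * P $$ (j,i)) * c i)"
      by (simp add: v_def sum_distrib_left sum_distrib_right mult_ac) (rule sum.swap)
    also have "\<dots> = (\<Sum>i\<in>I. (\<Sum>j<n. w k j * P $$ (j,i)) * c i)"
      using I c(2) by (intro sum.mono_neutral_right) auto
    finally show ?thesis using c(3) that by simp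
  qed
  have "\<sigma> * Re (qform m (gram n P m A) c) = (\<Sum>k<n. (\<sigma> * d k) * (cmod (\<Sum>j<n. w k j * v j))\<^sup>2)"
    unfolding qform_gram v_def[symmetric] q by (simp add: sum_distrib_left mult_ac)
  also have "\<dots> \<le> 0"
  proof (rule sum_nonpos)
    fix k assume "k \<in> {..<n}"
    then show "(\<sigma> * d k) * (cmod (\<Sum>j<n. w k j * v j))\<^sup>2 \<le> 0"
      using z[of k] by (cases "\<sigma> * d k > 0") (auto simp: mult_nonpos_nonneg)
  qed
  finally show False using def[of c] c(1,2) by fastforce
qed

definition has_inertia :: "nat \<Rightarrow> nat \<Rightarrow> nat \<Rightarrow> complex mat \<Rightarrow> bool" where
  "has_inertia n p q A \<longleftrightarrow> A \<in> carrier_mat n n \<and> mat_adjoint A = A \<and> det A \<noteq> 0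
     \<and> num_pos_eigenvalues A = p \<and> num_neg_eigenvalues A = q"

lemma card_pos_neg:
  fixes d :: "nat \<Rightarrow> real"
  assumes "\<And>k. k < n \<Longrightarrow> d k \<noteq> 0"
  shows "card {k. k < n \<and> d k > 0} + card {k. k < n \<and> d k < 0} = n"
proof -
  have "card {k. k < n \<and> d k > 0} + card {k. k < n \<and> d k < 0}
      = card ({k. k < n \<and> d k > 0} \<union> {k. k < n \<and> d k < 0})"
    by (rule card_Un_disjoint[symmetric]) auto
  also have "{k. k < n \<and> d k > 0} \<union> {k. k < n \<and> d k < 0} = {..<n}"
    using assms by (auto simp: neq_iff)
  finally show ?thesis by simp
qed

lemma card_pos_neg_le:
  fixes d :: "nat \<Rightarrow> real"
  shows "card {k. k < n \<and> d k > 0} + card {k. k < n \<and> d k < 0} \<le> n"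
proof -
  have "card {k. k < n \<and> d k > 0} + card {k. k < n \<and> d k < 0}
      = card ({k. k < n \<and> d k > 0} \<union> {k. k < n \<and> d k < 0})"
    by (rule card_Un_disjoint[symmetric]) auto
  also have "\<dots> \<le> card {..<n}" by (rule card_mono) auto
  finally show ?thesis by simp
qed

text \<open>
  The criterion is stated for a form that is merely definite on complementary coordinate subspaces, not
  diagonal: in this form it is stable under small perturbations.
\<close>

theorem sylvester_inertia:
  assumes A: "A \<in> carrier_mat n n" "mat_adjoint A = A" "det A \<noteq> 0"
    and I: "I \<subseteq> {..<n}"
    and pos: "\<And>c. \<exists>i\<in>I. c i \<noteq> 0 \<Longrightarrow> (\<And>i. i \<notin> I \<Longrightarrow> c i = 0) \<Longrightarrow> Re (qform n (gram n P n A) c) > 0"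
    and neg: "\<And>c. \<exists>i\<in>{..<n} - I. c i \<noteq> 0 \<Longrightarrow> (\<And>i. i \<notin> {..<n} - I \<Longrightarrow> c i = 0) \<Longrightarrow>
               Re (qform n (gram n P n A) c) < 0"
  shows "has_inertia n (card I) (n - card I) A"
proof -
  obtain U d where U: "U \<in> carrier_mat n n" "mat_adjoint U * U = 1\<^sub>m n"
    "gram n U n A = real_diag_mat n d" "det A = (\<Prod>k<n. complex_of_real (d k))"
    "num_pos_eigenvalues A = card {k. k < n \<and> d k > 0}"
    "num_neg_eigenvalues A = card {k. k < n \<and> d k < 0}"
    "\<And>v. qform n A v = of_real (\<Sum>k<n. d k * (cmod (\<Sum>j<n. cnj (U $$ (j,k)) * v j))\<^sup>2)"
    by (rule hermitian_inertia[OF A(1,2)]) (rule that; assumption)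
  have 1: "card I \<le> card {k. k < n \<and> 1 * d k > 0}"
    by (rule definite_index_bound[OF U(7) I, of 1 P]) (use pos in auto)
  have 2: "card ({..<n} - I) \<le> card {k. k < n \<and> (-1) * d k > 0}"
    by (rule definite_index_bound[OF U(7), of "{..<n} - I" n "-1" P]) (use neg in auto)
  have "card ({..<n} - I) = n - card I" "card I \<le> n"
    using I card_Diff_subset[of I "{..<n}"] card_mono[of "{..<n}" I] by (auto simp: finite_subset)
  then show ?thesis using 1 2 U(5,6) A card_pos_neg_le[of n d] unfolding has_inertia_def by auto
qed

lemma has_inertia_basis:
  assumes "has_inertia n p q A"
  obtains P d where "P \<in> carrier_mat n n" "gram n P n A = real_diag_mat n d"
    "\<And>k. k < n \<Longrightarrow> d k \<noteq> 0" "card {k. k < n \<and> d k > 0} = p" "card {k. k < n \<and> d k < 0} = q"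
proof -
  have A: "A \<in> carrier_mat n n" "mat_adjoint A = A" using assms by (auto simp: has_inertia_def)
  obtain U d where U: "U \<in> carrier_mat n n" "mat_adjoint U * U = 1\<^sub>m n"
    "gram n U n A = real_diag_mat n d" "det A = (\<Prod>k<n. complex_of_real (d k))"
    "num_pos_eigenvalues A = card {k. k < n \<and> d k > 0}"
    "num_neg_eigenvalues A = card {k. k < n \<and> d k < 0}"
    "\<And>v. qform n A v = of_real (\<Sum>k<n. d k * (cmod (\<Sum>j<n. cnj (U $$ (j,k)) * v j))\<^sup>2)"
    by (rule hermitian_inertia[OF A(1,2)]) (rule that; assumption)
  have "d k \<noteq> 0" if "k < n" for k
    using that U(4) assms by (auto simp: has_inertia_def)
  moreover have "card {k. k < n \<and> d k > 0} = p" "card {k. k < n \<and> d k < 0} = q"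
    using U(5,6) assms by (simp_all add: has_inertia_def)
  ultimately show ?thesis by (rule that[OF U(1,3)])
qed

lemma has_inertia_sum: "has_inertia n p q A \<Longrightarrow> p + q = n"
  by (erule has_inertia_basis) (use card_pos_neg in blast)

lemma has_inertiaI_diag:
  assumes A: "A \<in> carrier_mat n n" "mat_adjoint A = A" "det A \<noteq> 0"
    and g: "\<And>c. qform n (gram n P n A) c = of_real (\<Sum>k<n. d k * (cmod (c k))\<^sup>2)"
    and d: "\<And>k. k < n \<Longrightarrow> d k \<noteq> 0"
  shows "has_inertia n (card {k. k < n \<and> d k > 0}) (card {k. k < n \<and> d k < 0}) A"
proof -
  let ?I = "{k. k < n \<and> d k > 0}"
  have "has_inertia n (card ?I) (n - card ?I) A"
  proof (rule sylvester_inertia[OF A, of ?I P])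
    fix c :: "nat \<Rightarrow> complex" assume c: "\<exists>i\<in>?I. c i \<noteq> 0" "\<And>i. i \<notin> ?I \<Longrightarrow> c i = 0"
    then obtain i where i: "i < n" "d i > 0" "c i \<noteq> 0" by auto
    have "0 < (\<Sum>k<n. d k * (cmod (c k))\<^sup>2)"
    proof (rule sum_pos2[of _ i])
      fix k assume "k \<in> {..<n}"
      then show "0 \<le> d k * (cmod (c k))\<^sup>2" using c(2)[of k] by (cases "d k > 0") auto
    qed (use i in auto)
    then show "0 < Re (qform n (gram n P n A) c)" by (simp add: g)
  next
    fix c :: "nat \<Rightarrow> complex" assume c: "\<exists>i\<in>{..<n} - ?I. c i \<noteq> 0" "\<And>i. i \<notin> {..<n} - ?I \<Longrightarrow> c i = 0"
    then obtain i where i: "i < n" "d i < 0" "c i \<noteq> 0" using d by (auto simp: neq_iff)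
    have "0 < (\<Sum>k<n. - (d k * (cmod (c k))\<^sup>2))"
    proof (rule sum_pos2[of _ i])
      fix k assume "k \<in> {..<n}"
      then show "0 \<le> - (d k * (cmod (c k))\<^sup>2)" using c(2)[of k]
        by (cases "d k > 0") (auto simp: mult_nonpos_nonneg)
    qed (use i in \<open>auto simp: mult_neg_pos\<close>)
    then show "Re (qform n (gram n P n A) c) < 0" by (simp add: g sum_negf)
  qed auto
  moreover have "n - card ?I = card {k. k < n \<and> d k < 0}"
    using card_pos_neg[of n d, OF d] by linarith
  ultimately show ?thesis by simp
qed

section \<open>Signatures along paths and of bordered matrices\<close>

text \<open>
  Cauchy-Schwarz, which bounds \<open>(\<Sum>i<n. cmod (c i))\<^sup>2\<close> by \<open>n\<close> times the sum of squares.
\<close>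

lemma qform_perturb:
  assumes "\<And>i j. i < n \<Longrightarrow> j < n \<Longrightarrow> cmod (B $$ (i,j) - D $$ (i,j)) \<le> e"
  shows "cmod (qform n B c - qform n D c) \<le> e * real n * (\<Sum>i<n. (cmod (c i))\<^sup>2)"
proof (cases "n = 0")
  case False
  have e: "0 \<le> e" using assms[of 0 0] False norm_ge_zero order_trans by blast
  have "qform n B c - qform n D c = (\<Sum>r<n. \<Sum>s<n. cnj (c r) * (B $$ (r,s) - D $$ (r,s)) * c s)"
    by (simp add: qform_def algebra_simps sum_subtractf)
  also have "cmod \<dots> \<le> (\<Sum>r<n. \<Sum>s<n. cmod (c r) * e * cmod (c s))"
    by (intro sum_norm_le) (use e in \<open>auto simp: norm_mult intro!: mult_mono assms\<close>)
  also have "\<dots> = e * (\<Sum>r<n. cmod (c r))\<^sup>2"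
    by (simp add: power2_eq_square sum_product sum_distrib_left mult_ac)
  also have "\<dots> \<le> e * ((\<Sum>r<n. (cmod (c r))\<^sup>2) * card {..<n})"
    by (intro mult_left_mono sum_squared_le_sum_of_squares e)
  finally show ?thesis by (simp add: mult_ac)
qed (simp add: qform_def)

lemma gram_entry_continuous:
  assumes "\<And>r s. r < n \<Longrightarrow> s < n \<Longrightarrow> continuous_on X (\<lambda>t. M t $$ (r,s))" "i < k" "j < k"
  shows "continuous_on X (\<lambda>t. gram n C k (M t) $$ (i,j))"
  using assms by (simp add: gram_index) (intro continuous_intros; simp)

lemma det_continuous:
  fixes M :: "real \<Rightarrow> complex mat"
  assumes "\<And>t. t \<in> X \<Longrightarrow> M t \<in> carrier_mat k k"
    and "\<And>r s. r < k \<Longrightarrow> s < k \<Longrightarrow> continuous_on X (\<lambda>t. M t $$ (r,s))"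
  shows "continuous_on X (\<lambda>t. det (M t))"
proof -
  have "continuous_on X (\<lambda>t. \<Sum>p\<in>{p. p permutes {0..<k}}. signof p * (\<Prod>i = 0..<k. M t $$ (i, p i)))"
    by (intro continuous_intros assms(2)) (auto simp: permutes_in_image)
  then show ?thesis
    by (rule continuous_on_eq) (simp add: det_def'[OF assms(1)])
qed

text \<open>
  In a basis that diagonalizes \<open>M t0\<close>, the nearby matrices remain definite on the positive and on the
  negative coordinates.
\<close>

lemma has_inertia_nearby:
  assumes cont: "\<And>r s. r < n \<Longrightarrow> s < n \<Longrightarrow> continuous_on X (\<lambda>t. M t $$ (r,s))"
    and M: "\<And>t. t \<in> X \<Longrightarrow> M t \<in> carrier_mat n n" "\<And>t. t \<in> X \<Longrightarrow> mat_adjoint (M t) = M t"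
      "\<And>t. t \<in> X \<Longrightarrow> det (M t) \<noteq> 0"
    and t0: "t0 \<in> X" and h: "has_inertia n p q (M t0)"
  shows "eventually (\<lambda>t. has_inertia n p q (M t)) (at t0 within X)"
proof -
  from h obtain P d where P: "P \<in> carrier_mat n n" "gram n P n (M t0) = real_diag_mat n d"
    and d: "\<And>k. k < n \<Longrightarrow> d k \<noteq> 0" and p: "card {k. k < n \<and> d k > 0} = p" "card {k. k < n \<and> d k < 0} = q"
    by (rule has_inertia_basis) (rule that; assumption)
  let ?I = "{k. k < n \<and> d k > 0}"
  define \<delta> where "\<delta> = Min (insert 1 ((\<lambda>k. \<bar>d k\<bar>) ` {..<n}))"
  have \<delta>: "\<delta> > 0" "\<And>k. k < n \<Longrightarrow> \<delta> \<le> \<bar>d k\<bar>"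
    using d by (auto simp: \<delta>_def)
  \<comment> \<open>a perturbation of all entries by \<open>e\<close> changes the form by at most \<open>e * n\<close> times the squared
    norm, which has to stay below the smallest eigenvalue in absolute value\<close>
  define e where "e = \<delta> / (real n + 1)"
  have e: "e > 0" "e * real n < \<delta>" using \<delta> by (auto simp: e_def field_simps)
  have "eventually (\<lambda>t. \<forall>ij\<in>{..<n} \<times> {..<n}. dist (gram n P n (M t) $$ ij) (real_diag_mat n d $$ ij) < e) (at t0 within X)"
  proof (rule eventually_ball_finite)
    show "\<forall>ij\<in>{..<n} \<times> {..<n}. eventually (\<lambda>t. dist (gram n P n (M t) $$ ij) (real_diag_mat n d $$ ij) < e) (at t0 within X)"
    proof
      fix ij assume "ij \<in> {..<n} \<times> {..<n}"
      then have "continuous_on X (\<lambda>t. gram n P n (M t) $$ ij)"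
        using gram_entry_continuous[OF cont] by auto
      then have "((\<lambda>t. gram n P n (M t) $$ ij) \<longlongrightarrow> gram n P n (M t0) $$ ij) (at t0 within X)"
        using t0 by (simp add: continuous_on_def)
      then show "eventually (\<lambda>t. dist (gram n P n (M t) $$ ij) (real_diag_mat n d $$ ij) < e) (at t0 within X)"
        using tendstoD[OF _ e(1)] P(2) by metis
    qed
  qed simp
  moreover have "eventually (\<lambda>t. t \<in> X) (at t0 within X)" by (simp add: eventually_at_filter)
  ultimately show ?thesis
  proof eventually_elim
    case (elim t)
    have est: "\<bar>Re (qform n (gram n P n (M t)) c) - (\<Sum>k<n. d k * (cmod (c k))\<^sup>2)\<bar> \<le> e * real n * (\<Sum>i<n. (cmod (c i))\<^sup>2)" for c
    proof -
      have "cmod (qform n (gram n P n (M t)) c - qform n (real_diag_mat n d) c) \<le> e * real n * (\<Sum>i<n. (cmod (c i))\<^sup>2)"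
        by (rule qform_perturb) (use elim(1) in \<open>auto simp: dist_norm less_imp_le\<close>)
      then show ?thesis
        using abs_Re_le_cmod[of "qform n (gram n P n (M t)) c - qform n (real_diag_mat n d) c"]
        unfolding qform_real_diag by simp
    qed
    have sq: "e * real n * (\<Sum>i<n. (cmod (c i))\<^sup>2) < \<delta> * (\<Sum>i<n. (cmod (c i))\<^sup>2)" if "c i \<noteq> 0" "i < n" for c i
    proof -
      have "0 < (\<Sum>i<n. (cmod (c i))\<^sup>2)" using that by (intro sum_pos2[of _ i]) auto
      then show ?thesis using e by (intro mult_strict_right_mono)
    qed
    have "has_inertia n (card ?I) (n - card ?I) (M t)"
    proof (rule sylvester_inertia[of _ _ ?I P])
      fix c :: "nat \<Rightarrow> complex" assume c: "\<exists>i\<in>?I. c i \<noteq> 0" "\<And>i. i \<notin> ?I \<Longrightarrow> c i = 0"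
      then obtain i where i: "i < n" "c i \<noteq> 0" by auto
      have "\<delta> * (\<Sum>i<n. (cmod (c i))\<^sup>2) \<le> (\<Sum>k<n. d k * (cmod (c k))\<^sup>2)"
        unfolding sum_distrib_left
      proof (rule sum_mono)
        fix k assume "k \<in> {..<n}"
        then show "\<delta> * (cmod (c k))\<^sup>2 \<le> d k * (cmod (c k))\<^sup>2"
          using c(2)[of k] \<delta>(2)[of k] by (cases "d k > 0") (auto intro!: mult_right_mono)
      qed
      then show "0 < Re (qform n (gram n P n (M t)) c)" using est[of c] sq[of c i] i by linarith
    next
      fix c :: "nat \<Rightarrow> complex" assume c: "\<exists>i\<in>{..<n} - ?I. c i \<noteq> 0" "\<And>i. i \<notin> {..<n} - ?I \<Longrightarrow> c i = 0"
      then obtain i where i: "i < n" "c i \<noteq> 0" by auto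
      have "(\<Sum>k<n. d k * (cmod (c k))\<^sup>2) \<le> (\<Sum>k<n. - \<delta> * (cmod (c k))\<^sup>2)"
      proof (rule sum_mono)
        fix k assume "k \<in> {..<n}"
        then show "d k * (cmod (c k))\<^sup>2 \<le> - \<delta> * (cmod (c k))\<^sup>2"
          using c(2)[of k] \<delta>(2)[of k] mult_right_mono[of "d k" "- \<delta>" "(cmod (c k))\<^sup>2"]
          by (cases "d k > 0") auto
      qed
      then have "(\<Sum>k<n. d k * (cmod (c k))\<^sup>2) \<le> - (\<delta> * (\<Sum>i<n. (cmod (c i))\<^sup>2))"
        by (simp add: sum_distrib_left sum_negf)
      then show "Re (qform n (gram n P n (M t)) c) < 0" using est[of c] sq[of c i] i by linarith
    qed (use M elim(2) in auto)
    moreover have "n - card ?I = q" using card_pos_neg[of n d, OF d] p by linarith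
    ultimately show ?case using p by simp
  qed
qed

theorem has_inertia_along_path:
  fixes M :: "real \<Rightarrow> complex mat"
  assumes cont: "\<And>r s. r < n \<Longrightarrow> s < n \<Longrightarrow> continuous_on {a..b} (\<lambda>t. M t $$ (r,s))"
    and M: "\<And>t. t \<in> {a..b} \<Longrightarrow> M t \<in> carrier_mat n n" "\<And>t. t \<in> {a..b} \<Longrightarrow> mat_adjoint (M t) = M t"
      "\<And>t. t \<in> {a..b} \<Longrightarrow> det (M t) \<noteq> 0"
    and st: "s \<in> {a..b}" "t \<in> {a..b}" and h: "has_inertia n p q (M s)"
  shows "has_inertia n p q (M t)"
proof -
  let ?f = "\<lambda>t. (num_pos_eigenvalues (M t), num_neg_eigenvalues (M t))"
  have "?f s = ?f t"
  proof (rule connected_local_const[OF connected_Icc st])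
    show "\<forall>u\<in>{a..b}. eventually (\<lambda>v. ?f u = ?f v) (at u within {a..b})"
    proof
      fix u assume u: "u \<in> {a..b}"
      have "has_inertia n (num_pos_eigenvalues (M u)) (num_neg_eigenvalues (M u)) (M u)"
        using M u by (simp add: has_inertia_def)
      from has_inertia_nearby[OF cont M u this]
      show "eventually (\<lambda>v. ?f u = ?f v) (at u within {a..b})"
        by (rule eventually_mono) (auto simp: has_inertia_def)
    qed
  qed
  then show ?thesis using h M st by (simp add: has_inertia_def)
qed

text \<open>
  The number \<open>det A / det G\<close> is the Schur complement of \<open>G\<close> in \<open>A\<close>: the last basis vector can be
  replaced by a vector orthogonal to all the others, on which the form has this value.
\<close>

lemma bordered_inertia:
  assumes A: "A \<in> carrier_mat (Suc k) (Suc k)" "mat_adjoint A = A"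
    and G: "G = mat k k (\<lambda>ij. A $$ ij)" and h: "has_inertia k p q G"
    and s: "Re (det A / det G) \<noteq> 0"
  shows "has_inertia (Suc k) (if Re (det A / det G) > 0 then Suc p else p)
           (if Re (det A / det G) > 0 then q else Suc q) A"
proof -
  let ?s = "det A / det G"
  have dG: "det G \<noteq> 0" using h by (simp add: has_inertia_def)
  from h obtain PG d where PG: "PG \<in> carrier_mat k k" "gram k PG k G = real_diag_mat k d"
    and d: "\<And>i. i < k \<Longrightarrow> d i \<noteq> 0" and p: "card {i. i < k \<and> d i > 0} = p" "card {i. i < k \<and> d i < 0} = q"
    by (rule has_inertia_basis) (rule that; assumption)
  \<comment> \<open>the last column of the adjugate, scaled to have last entry 1, so that \<open>A w\<close> is a multiple of the
    last unit vector\<close>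
  define w where "w i = cofactor A k i / det G" for i
  have "mat_delete A k k = G" using A(1) unfolding G mat_delete_def by (intro eq_matI) auto
  then have wk: "w k = 1" using dG by (simp add: w_def cofactor_def)
  have Aw: "(\<Sum>i<Suc k. A $$ (r,i) * w i) = (if r = k then ?s else 0)" if r: "r < Suc k" for r
  proof -
    have "(A * adj_mat A) $$ (r,k) = (\<Sum>i<Suc k. A $$ (r,i) * cofactor A k i)"
      using A(1) r by (simp add: scalar_prod_def adj_mat_def atLeast0LessThan del: sum.lessThan_Suc)
    also have "(A * adj_mat A) $$ (r,k) = (det A \<cdot>\<^sub>m 1\<^sub>m (Suc k)) $$ (r,k)"
      using adj_mat(2)[OF A(1)] by simp
    finally have "(\<Sum>i<Suc k. A $$ (r,i) * cofactor A k i) = (if r = k then det A else 0)"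
      using r by (simp del: sum.lessThan_Suc split: if_splits)
    then show ?thesis
      by (simp add: w_def sum_divide_distrib[symmetric] del: sum.lessThan_Suc)
  qed
  define P where "P = mat (Suc k) (Suc k) (\<lambda>(r,j). if j < k then (if r < k then PG $$ (r,j) else 0) else w r)"
  have Pi: "P $$ (r,j) = (if j < k then (if r < k then PG $$ (r,j) else 0) else w r)"
    if "r < Suc k" "j < Suc k" for r j using that by (simp add: P_def)
  let ?B = "gram (Suc k) P (Suc k) A"
  have hB: "cnj (?B $$ (j,i)) = ?B $$ (i,j)" if "i < Suc k" "j < Suc k" for i j
    using hermitian_index[OF gram_carrier gram_hermitian[OF A] that] .
  have Bk: "?B $$ (i,k) = (if i = k then ?s else 0)" if i: "i < Suc k" for i
  proof -
    have "?B $$ (i,k) = (\<Sum>r<Suc k. cnj (P $$ (r,i)) * (\<Sum>s<Suc k. A $$ (r,s) * w s))"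
      using i by (simp add: gram_index Pi sum_distrib_left mult.assoc del: sum.lessThan_Suc)
    also have "\<dots> = (\<Sum>r<Suc k. if r = k then cnj (P $$ (r,i)) * ?s else 0)"
      by (intro sum.cong refl) (use Aw in \<open>simp del: sum.lessThan_Suc\<close>)
    also have "\<dots> = cnj (P $$ (k,i)) * ?s" by simp
    finally show ?thesis using i wk by (simp add: Pi)
  qed
  have sr: "?s = of_real (Re ?s)"
  proof -
    have "cnj ?s = ?s" using hB[of k k] unfolding Bk[OF lessI] by simp
    then show ?thesis by (metis Reals_cnj_iff of_real_Re)
  qed
  have Bik: "?B $$ (k,j) = 0" if "j < k" for j
    using hB[of k j] Bk[of j] that by simp
  have Bij: "?B $$ (i,j) = real_diag_mat k d $$ (i,j)" if "i < k" "j < k" for i j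
  proof -
    have "?B $$ (i,j) = (\<Sum>r<k. \<Sum>s<k. cnj (PG $$ (r,i)) * A $$ (r,s) * PG $$ (s,j))"
      using that by (simp add: gram_index Pi)
    also have "\<dots> = gram k PG k G $$ (i,j)" using that by (simp add: gram_index G)
    finally show ?thesis using PG(2) by simp
  qed
  define d' where "d' i = (if i = k then Re ?s else d i)" for i
  have BD: "?B = real_diag_mat (Suc k) d'"
  proof (rule eq_matI)
    fix i j assume "i < dim_row (real_diag_mat (Suc k) d')" "j < dim_col (real_diag_mat (Suc k) d')"
    then have ij: "i < Suc k" "j < Suc k" by (auto simp: real_diag_mat_def)
    consider "j = k" | "i = k" "j < k" | "i < k" "j < k" using ij by linarith
    then show "?B $$ (i,j) = real_diag_mat (Suc k) d' $$ (i,j)"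
    proof cases
      case 1
      then show ?thesis using Bk[OF ij(1)] sr ij by (simp add: real_diag_mat_def d'_def)
    next
      case 2
      then show ?thesis using Bik by (simp add: real_diag_mat_def)
    next
      case 3
      then show ?thesis using Bij by (simp add: real_diag_mat_def d'_def)
    qed
  qed (auto simp: real_diag_mat_def)
  have dA: "det A \<noteq> 0" using s by auto
  have H: "has_inertia (Suc k) (card {i. i < Suc k \<and> d' i > 0}) (card {i. i < Suc k \<and> d' i < 0}) A"
    by (rule has_inertiaI_diag[OF A dA, of P]) (use d s in \<open>auto simp: BD qform_real_diag d'_def\<close>)
  have c1: "{i. i < Suc k \<and> d' i > 0} = (if Re ?s > 0 then insert k {i. i < k \<and> d i > 0} else {i. i < k \<and> d i > 0})"
    by (auto simp: d'_def less_Suc_eq)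
  have c2: "{i. i < Suc k \<and> d' i < 0} = (if Re ?s < 0 then insert k {i. i < k \<and> d i < 0} else {i. i < k \<and> d i < 0})"
    by (auto simp: d'_def less_Suc_eq)
  show ?thesis using H s unfolding c1 c2 by (auto simp: p)
qed

section \<open>Paths of matrices and determinants\<close>

lemma pathin_mat_topologyI:
  fixes g :: "real \<Rightarrow> complex mat"
  assumes "\<And>t. t \<in> {0..1} \<Longrightarrow> g t \<in> carrier_mat N N"
    and "\<And>i j. i < N \<Longrightarrow> j < N \<Longrightarrow> continuous_on {0..1} (\<lambda>t. g t $$ (i,j))"
  shows "pathin (mat_topology N) g"
  unfolding pathin_def mat_topology_def
proof (rule continuous_map_pullback')
  show "continuous_map (top_of_set {0..1}) (product_topology (\<lambda>_. euclidean) ({0..<N} \<times> {0..<N}))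
          ((\<lambda>A. restrict (\<lambda>ij. A $$ ij) ({0..<N} \<times> {0..<N})) \<circ> g)"
    by (rule continuous_map_coordinatewise_then_product) (auto simp: assms(2))
qed (use assms(1) in auto)

lemma pathin_mat_topologyD:
  assumes "pathin (mat_topology N) g" "i < N" "j < N"
  shows "continuous_on {0..1} (\<lambda>t. g t $$ (i,j))"
proof -
  have "continuous_map (mat_topology N) euclidean (\<lambda>A. A $$ (i,j))"
  proof -
    have "continuous_map (product_topology (\<lambda>_. euclidean) ({0..<N} \<times> {0..<N})) euclidean
            (\<lambda>x :: nat \<times> nat \<Rightarrow> complex. x (i,j))"
      by (rule continuous_map_product_projection) (use assms in auto)
    from continuous_map_pullback[OF this, of "carrier_mat N N" "\<lambda>A. restrict (\<lambda>ij. A $$ ij) ({0..<N} \<times> {0..<N})"]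
    show ?thesis using assms by (simp add: mat_topology_def o_def)
  qed
  from pathin_compose[OF assms(1) this] show ?thesis
    by (simp add: pathin_def o_def)
qed

definition joined :: "nat \<Rightarrow> complex mat set \<Rightarrow> complex mat \<Rightarrow> complex mat \<Rightarrow> bool" where
  "joined N S = path_component_of (subtopology (mat_topology N) S)"

lemma joined_sym: "joined N S A B \<Longrightarrow> joined N S B A"
  by (simp add: joined_def path_component_of_sym)

lemma joined_trans: "joined N S A B \<Longrightarrow> joined N S B D \<Longrightarrow> joined N S A D"
  unfolding joined_def by (rule path_component_of_trans)

lemma joinedI:
  fixes g :: "real \<Rightarrow> complex mat"
  assumes "S \<subseteq> carrier_mat N N" "\<And>t. t \<in> {0..1} \<Longrightarrow> g t \<in> S"
    and "\<And>i j. i < N \<Longrightarrow> j < N \<Longrightarrow> continuous_on {0..1} (\<lambda>t. g t $$ (i,j))"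
  shows "joined N S (g 0) (g 1)"
proof -
  have "pathin (subtopology (mat_topology N) S) g"
    unfolding pathin_subtopology using assms by (auto intro!: pathin_mat_topologyI)
  then show ?thesis unfolding joined_def path_component_of_def by blast
qed

lemma joinedE:
  assumes "joined N S A B"
  obtains g :: "real \<Rightarrow> complex mat" where "\<And>t. t \<in> {0..1} \<Longrightarrow> g t \<in> S" "g 0 = A" "g 1 = B"
    "\<And>i j. i < N \<Longrightarrow> j < N \<Longrightarrow> continuous_on {0..1} (\<lambda>t. g t $$ (i,j))"
proof -
  from assms obtain g where "pathin (subtopology (mat_topology N) S) g" "g 0 = A" "g 1 = B"
    unfolding joined_def path_component_of_def by blast
  then show ?thesis
    using that[of g] pathin_mat_topologyD[of N g] by (simp add: pathin_subtopology)
qed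

lemma joined_in:
  assumes "joined N S A B"
  shows "A \<in> S" "B \<in> S"
proof -
  obtain g :: "real \<Rightarrow> complex mat" where "\<And>t. t \<in> {0..1} \<Longrightarrow> g t \<in> S" "g 0 = A" "g 1 = B"
    using joinedE[OF assms] by blast
  then show "A \<in> S" "B \<in> S" by force+
qed

lemma det_add_corner:
  fixes M :: "complex mat"
  assumes M: "M \<in> carrier_mat (Suc k) (Suc k)"
  shows "det (mat (Suc k) (Suc k) (\<lambda>(i,j). M $$ (i,j) + (if i = k \<and> j = k then x else 0)))
     = det M + x * det (mat k k (\<lambda>ij. M $$ ij))"
proof -
  let ?M = "mat (Suc k) (Suc k) (\<lambda>(i,j). M $$ (i,j) + (if i = k \<and> j = k then x else 0))"
  have c: "cofactor ?M k j = cofactor M k j" if "j < Suc k" for j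
  proof -
    have "mat_delete ?M k j = mat_delete M k j"
      using M that unfolding mat_delete_def by (intro eq_matI) auto
    then show ?thesis by (simp add: cofactor_def)
  qed
  have "mat_delete M k k = mat k k (\<lambda>ij. M $$ ij)"
    using M unfolding mat_delete_def by (intro eq_matI) auto
  then have ck: "cofactor M k k = det (mat k k (\<lambda>ij. M $$ ij))" by (simp add: cofactor_def)
  have "det ?M = (\<Sum>j<Suc k. ?M $$ (k,j) * cofactor ?M k j)"
    by (rule laplace_expansion_row) auto
  also have "\<dots> = (\<Sum>j<Suc k. M $$ (k,j) * cofactor M k j + (if j = k then x * cofactor M k k else 0))"
    by (intro sum.cong refl) (auto simp: c algebra_simps)
  also have "\<dots> = det M + x * cofactor M k k"
    unfolding sum.distrib using laplace_expansion_row[OF M, of k] by simp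
  finally show ?thesis unfolding ck .
qed

lemma det_hermitian_real:
  assumes "A \<in> carrier_mat n n" "mat_adjoint A = A"
  shows "det A = of_real (Re (det A))"
proof -
  obtain U d where "det A = (\<Prod>k<n. complex_of_real (d k))"
    by (rule hermitian_inertia[OF assms]) (rule that; assumption)
  then have "det A = complex_of_real (\<Prod>k<n. d k)" by simp
  then show ?thesis by (metis Re_complex_of_real)
qed

text \<open>
  The polynomial \<open>det (s A + E)\<close> in \<open>s\<close> does not vanish at \<open>s = 0\<close>, hence not at some large real
  \<open>s\<close>; substitute \<open>t = 1 / s\<close>.
\<close>

lemma det_perturbation_nonzero:
  fixes A E :: "complex mat"
  assumes A: "A \<in> carrier_mat k k" and E: "E \<in> carrier_mat k k" "det E \<noteq> 0" and e: "e > 0"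
  shows "\<exists>t. 0 < t \<and> t < e \<and> det (A + complex_of_real t \<cdot>\<^sub>m E) \<noteq> 0"
proof -
  define f where "f = (\<Sum>p\<in>{p. p permutes {0..<k}}. Polynomial.smult (signof p) (\<Prod>i = 0..<k. [:E $$ (i, p i), A $$ (i, p i):]))"
  have f: "poly f s = det (s \<cdot>\<^sub>m A + E)" for s
  proof -
    have "det (s \<cdot>\<^sub>m A + E) = (\<Sum>p\<in>{p. p permutes {0..<k}}. signof p * (\<Prod>i = 0..<k. (s \<cdot>\<^sub>m A + E) $$ (i, p i)))"
      using A E by (intro det_def') auto
    also have "\<dots> = (\<Sum>p\<in>{p. p permutes {0..<k}}. signof p * (\<Prod>i = 0..<k. E $$ (i, p i) + s * A $$ (i, p i)))"
      using A E by (intro sum.cong refl arg_cong2[of _ _ _ _ "(*)"] prod.cong) (auto simp: permutes_in_image)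
    finally show ?thesis by (simp add: f_def poly_sum poly_prod mult.commute)
  qed
  have "0 \<cdot>\<^sub>m A + E = E" using A E by (intro eq_matI) auto
  then have "poly f 0 \<noteq> 0" unfolding f using E by simp
  then have "f \<noteq> 0" by auto
  then have fin: "finite {s. poly f s = 0}" by (rule poly_roots_finite)
  have "infinite (complex_of_real ` {1/e<..})"
    by (subst finite_image_iff) (auto simp: inj_on_def infinite_Ioi)
  then have "\<not> complex_of_real ` {1/e<..} \<subseteq> {s. poly f s = 0}"
    using fin infinite_super by blast
  then obtain s where s: "s > 1/e" "poly f (complex_of_real s) \<noteq> 0" by auto
  have s0: "s > 0" using s(1) e by (meson less_trans zero_less_divide_1_iff)
  have "complex_of_real s \<cdot>\<^sub>m (A + complex_of_real (1/s) \<cdot>\<^sub>m E) = complex_of_real s \<cdot>\<^sub>m A + E"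
    using A E s0 by (intro eq_matI) (auto simp: algebra_simps)
  then have "det (complex_of_real s \<cdot>\<^sub>m (A + complex_of_real (1/s) \<cdot>\<^sub>m E)) \<noteq> 0" using s(2) f by simp
  then have "det (A + complex_of_real (1/s) \<cdot>\<^sub>m E) \<noteq> 0" by auto
  then show ?thesis using s(1) s0 e by (intro exI[of _ "1/s"]) (auto simp: field_simps)
qed

lemma exists_kernel_function:
  fixes H :: "complex mat"
  assumes "H \<in> carrier_mat k k" "det H = 0"
  shows "\<exists>u :: nat \<Rightarrow> complex. (\<exists>i<k. u i \<noteq> 0) \<and> (\<forall>r<k. (\<Sum>s<k. H $$ (r,s) * u s) = 0)"
proof -
  obtain v where v: "v \<in> carrier_vec k" "v \<noteq> 0\<^sub>v k" "H *\<^sub>v v = 0\<^sub>v k"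
    using det_0_iff_vec_prod_zero_field[OF assms(1)] assms(2) by auto
  have "(\<Sum>s<k. H $$ (r,s) * v $ s) = 0" if "r < k" for r
  proof -
    have "(H *\<^sub>v v) $ r = (\<Sum>s<k. H $$ (r,s) * v $ s)"
      using v(1) assms(1) that by (simp add: scalar_prod_def atLeast0LessThan)
    then show ?thesis using v(3) that by simp
  qed
  moreover have "\<exists>i<k. v $ i \<noteq> 0" using v by (metis carrier_vecD eq_vecI index_zero_vec)
  ultimately show ?thesis by (intro exI[of _ "\<lambda>i. v $ i"]) auto
qed

lemma kernel_trivial:
  fixes H :: "complex mat"
  assumes H: "H \<in> carrier_mat k k" "det H \<noteq> 0" and u: "\<And>r. r < k \<Longrightarrow> (\<Sum>s<k. H $$ (r,s) * u s) = 0" and i: "i < k"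
  shows "u i = 0"
proof (rule ccontr)
  assume "u i \<noteq> 0"
  moreover have "H *\<^sub>v vec k u = 0\<^sub>v k"
    using H u by (intro eq_vecI) (auto simp: scalar_prod_def atLeast0LessThan)
  ultimately have "det H = 0"
    using det_0_iff_vec_prod_zero_field[OF H(1)] i by (metis index_vec index_zero_vec(1) vec_carrier)
  then show False using H by simp
qed

text \<open>
  Let \<open>H\<close> be the leading block of size \<open>j + 1\<close>. It is singular, but its kernel is spanned by the single
  vector \<open>u\<close>, because the leading block of size \<open>j\<close> is nonsingular. If the last column of \<open>M\<close> is not
  orthogonal to \<open>u\<close>, then a kernel vector of \<open>M\<close> has last entry 0 (pair the first rows with \<open>u\<close>), so it
  is a multiple of \<open>u\<close>, and the last row shows that the multiple is 0.
\<close>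

lemma double_border_nonsingular:
  fixes M :: "complex mat"
  assumes M: "M \<in> carrier_mat (Suc (Suc j)) (Suc (Suc j))" "mat_adjoint M = M"
    and lead: "det (mat j j (\<lambda>ij. M $$ ij)) \<noteq> 0"
    and u: "\<And>r. r < Suc j \<Longrightarrow> (\<Sum>s<Suc j. M $$ (r,s) * u s) = 0" "u j \<noteq> 0"
    and c: "(\<Sum>r<Suc j. cnj (u r) * M $$ (r, Suc j)) \<noteq> 0"
  shows "det M \<noteq> 0"
proof
  assume "det M = 0"
  then obtain v where v: "\<exists>i<Suc (Suc j). v i \<noteq> 0"
    "\<And>r. r < Suc (Suc j) \<Longrightarrow> (\<Sum>s<Suc (Suc j). M $$ (r,s) * v s) = 0"
    using exists_kernel_function[OF M(1)] by blast
  let ?y = "v (Suc j)"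
  have rows: "(\<Sum>s<Suc j. M $$ (r,s) * v s) + M $$ (r, Suc j) * ?y = 0" if "r < Suc (Suc j)" for r
    using v(2)[OF that] by (simp add: add.assoc)
  have "0 = (\<Sum>r<Suc j. cnj (u r) * ((\<Sum>s<Suc j. M $$ (r,s) * v s) + M $$ (r, Suc j) * ?y))"
    by (rule sum.neutral[symmetric]) (use rows in \<open>simp del: sum.lessThan_Suc\<close>)
  also have "\<dots> = (\<Sum>r<Suc j. \<Sum>s<Suc j. cnj (u r) * M $$ (r,s) * v s)
      + (\<Sum>r<Suc j. cnj (u r) * M $$ (r, Suc j)) * ?y"
    by (simp add: algebra_simps sum.distrib sum_distrib_left sum_distrib_right del: sum.lessThan_Suc)
  also have "(\<Sum>r<Suc j. \<Sum>s<Suc j. cnj (u r) * M $$ (r,s) * v s)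
      = (\<Sum>s<Suc j. cnj (\<Sum>r<Suc j. M $$ (s,r) * u r) * v s)"
    by (subst sum.swap)
       (use hermitian_index[OF M] in \<open>simp add: sum_distrib_left sum_distrib_right mult_ac del: sum.lessThan_Suc\<close>)
  also have "\<dots> = 0" using u(1) by (simp del: sum.lessThan_Suc)
  finally have y: "?y = 0" using c by (simp del: sum.lessThan_Suc)
  define a where "a = v j / u j"
  have z: "v i - a * u i = 0" if i: "i < j" for i
  proof (rule kernel_trivial[OF _ lead _ i, of "\<lambda>i. v i - a * u i"])
    fix r assume r: "r < j"
    have "(\<Sum>s<Suc j. M $$ (r,s) * (v s - a * u s)) = (\<Sum>s<Suc j. M $$ (r,s) * v s) - a * (\<Sum>s<Suc j. M $$ (r,s) * u s)"
      by (simp add: algebra_simps sum_subtractf sum_distrib_left del: sum.lessThan_Suc)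
    also have "\<dots> = 0" using rows[of r] u(1)[of r] y r by (simp del: sum.lessThan_Suc)
    finally show "(\<Sum>s<j. mat j j (\<lambda>ij. M $$ ij) $$ (r,s) * (v s - a * u s)) = 0"
      using r u(2) by (simp add: a_def)
  qed auto
  have va: "v i = a * u i" if "i < Suc j" for i
    using z[of i] that u(2) by (cases "i = j") (auto simp: a_def)
  let ?K = "\<Sum>r<Suc j. cnj (u r) * M $$ (r, Suc j)"
  have e: "(\<Sum>s<Suc j. M $$ (Suc j, s) * v s) = a * cnj ?K"
    using hermitian_index[OF M] va
    by (simp add: sum_distrib_left mult_ac del: sum.lessThan_Suc)
  have "a * cnj ?K = 0" using rows[of "Suc j"] y unfolding e by simp
  moreover have "cnj ?K \<noteq> 0" using c by (simp only: complex_cnj_zero_iff) simp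
  ultimately have "a = 0" by (simp only: mult_eq_0_iff) simp
  then have "v i = 0" if "i < Suc (Suc j)" for i
    using va[of i] y that by (cases "i = Suc j") auto
  then show False using v(1) by auto
qed

section \<open>Connectedness of hermitian forms adapted to a flag\<close>

text \<open>
  A real vector space of hermitian forms together with a sequence of vectors, the columns of \<open>C\<close>, such
  that the last diagonal entry of each leading Gram matrix can be varied alone, and that the entry just
  above the last diagonal entry can be varied while the smaller Gram matrix and the entries further up in
  the last column stay fixed.
\<close>

locale flagged_hermitian_space =
  fixes N :: nat and C :: "complex mat" and L :: "complex mat set"
  assumes carrier: "L \<subseteq> carrier_mat N N"
    and hermitian: "\<And>A. A \<in> L \<Longrightarrow> mat_adjoint A = A"
    and zero: "0\<^sub>m N N \<in> L"
    and add_smult: "\<And>A B x. A \<in> L \<Longrightarrow> B \<in> L \<Longrightarrow> A + complex_of_real x \<cdot>\<^sub>m B \<in> L"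
    and corner: "\<And>k. k < N \<Longrightarrow> \<exists>D\<in>L. \<forall>i\<le>k. \<forall>j\<le>k.
        gram N C (Suc k) D $$ (i,j) = (if i = k \<and> j = k then 1 else 0)"
    and off_corner: "\<And>k. Suc k < N \<Longrightarrow> \<exists>F\<in>L. (\<forall>i\<le>k. \<forall>j\<le>k. gram N C (Suc (Suc k)) F $$ (i,j) = 0)
        \<and> (\<forall>i<k. gram N C (Suc (Suc k)) F $$ (i, Suc k) = 0) \<and> gram N C (Suc (Suc k)) F $$ (k, Suc k) \<noteq> 0"
begin

abbreviation G :: "nat \<Rightarrow> complex mat \<Rightarrow> complex mat" where "G k \<equiv> gram N C k"

text \<open>
  Only the leading \<open>k \<times> k\<close> Gram matrix is constrained, but the elements are forms in all of
  \<open>L\<close>: restriction to the smaller Gram matrix then needs no separate spaces, and the fibres of the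
  restriction are affine subspaces of \<open>L\<close>.
\<close>

definition S :: "nat \<Rightarrow> nat \<Rightarrow> nat \<Rightarrow> complex mat set" where
  "S k p q = {A \<in> L. has_inertia k p q (G k A)}"

text \<open>
  The Schur complement of \<open>G k A\<close> in \<open>G (Suc k) A\<close>; its sign tells how the signature grows from
  \<open>k\<close> to \<open>k + 1\<close>.
\<close>

definition schur_ratio :: "nat \<Rightarrow> complex mat \<Rightarrow> real" where
  "schur_ratio k A = Re (det (G (Suc k) A) / det (G k A))"

lemma S_dest: "A \<in> S k p q \<Longrightarrow> A \<in> L" "A \<in> S k p q \<Longrightarrow> has_inertia k p q (G k A)"
  "A \<in> S k p q \<Longrightarrow> det (G k A) \<noteq> 0"
  by (auto simp: S_def has_inertia_def)

lemma S_carrier: "S k p q \<subseteq> carrier_mat N N"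
  using carrier by (auto simp: S_def)

lemma L_carrier: "A \<in> L \<Longrightarrow> A \<in> carrier_mat N N"
  using carrier by auto

lemma G_hermitian: "A \<in> L \<Longrightarrow> mat_adjoint (G k A) = G k A"
  by (rule gram_hermitian[OF L_carrier hermitian])

lemma det_G_real: "A \<in> L \<Longrightarrow> det (G k A) = of_real (Re (det (G k A)))"
  by (rule det_hermitian_real[OF gram_carrier G_hermitian])

lemma G_leading: "G k A = mat k k (\<lambda>ij. G (Suc k) A $$ ij)"
  by (intro eq_matI) (auto simp: gram_index)

lemma G_add_smult:
  assumes "A \<in> L" "B \<in> L"
  shows "G k (A + x \<cdot>\<^sub>m B) = G k A + x \<cdot>\<^sub>m G k B"
  using L_carrier[OF assms(1)] L_carrier[OF assms(2)]
  by (intro eq_matI)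
     (auto simp: gram_index algebra_simps sum.distrib sum_distrib_left)

lemma G_add_smult_index:
  assumes "A \<in> L" "B \<in> L" "i < k" "j < k"
  shows "G k (A + x \<cdot>\<^sub>m B) $$ (i,j) = G k A $$ (i,j) + x * G k B $$ (i,j)"
  unfolding G_add_smult[OF assms(1,2)] using assms(3,4) by simp

lemma entry_continuous:
  assumes "A \<in> L" "B \<in> L" "i < N" "j < N"
  shows "continuous_on X (\<lambda>t. (A + complex_of_real (f t) \<cdot>\<^sub>m B) $$ (i,j)) \<longleftrightarrow>
    continuous_on X (\<lambda>t. A $$ (i,j) + complex_of_real (f t) * B $$ (i,j))"
  using L_carrier[OF assms(1)] L_carrier[OF assms(2)] assms(3,4) by simp

lemma S_zero: "S 0 0 0 = L"
proof -
  have "has_inertia 0 0 0 (G 0 A)" if A: "A \<in> L" for A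
  proof -
    have "num_pos_eigenvalues (G 0 A) = 0 \<and> num_neg_eigenvalues (G 0 A) = 0"
      by (rule hermitian_inertia[OF gram_carrier G_hermitian[OF A], of 0]) simp
    moreover have "det (G 0 A) = 1" by (simp add: det_dim_zero)
    ultimately show ?thesis using G_hermitian[OF A, of 0] by (simp add: has_inertia_def)
  qed
  then show ?thesis by (auto simp: S_def)
qed

lemma schur_ratio_nonzero:
  assumes "A \<in> L" "det (G k A) \<noteq> 0" "det (G (Suc k) A) \<noteq> 0"
  shows "schur_ratio k A \<noteq> 0"
proof -
  have "det (G (Suc k) A) / det (G k A) = of_real (Re (det (G (Suc k) A)) / Re (det (G k A)))"
    using det_G_real[OF assms(1), of k] det_G_real[OF assms(1), of "Suc k"] by (metis of_real_divide)
  then show ?thesis using assms(2,3) unfolding schur_ratio_def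
    by (metis Re_complex_of_real divide_eq_0_iff of_real_0)
qed

lemma S_Suc_pos: "A \<in> S k p q \<Longrightarrow> schur_ratio k A > 0 \<Longrightarrow> A \<in> S (Suc k) (Suc p) q"
  using bordered_inertia[OF gram_carrier G_hermitian G_leading, of A k p q]
  by (auto simp: S_def schur_ratio_def)

lemma S_Suc_neg: "A \<in> S k p q \<Longrightarrow> schur_ratio k A < 0 \<Longrightarrow> A \<in> S (Suc k) p (Suc q)"
  using bordered_inertia[OF gram_carrier G_hermitian G_leading, of A k p q]
  by (auto simp: S_def schur_ratio_def)

lemma S_unique: "A \<in> S k p q \<Longrightarrow> A \<in> S k p' q' \<Longrightarrow> p = p' \<and> q = q'"
  by (auto simp: S_def has_inertia_def)

lemma S_sum: "A \<in> S k p q \<Longrightarrow> p + q = k"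
  using has_inertia_sum by (auto simp: S_def)

lemma in_S: "A \<in> L \<Longrightarrow> det (G k A) \<noteq> 0 \<Longrightarrow>
    A \<in> S k (num_pos_eigenvalues (G k A)) (num_neg_eigenvalues (G k A))"
  using G_hermitian by (simp add: S_def has_inertia_def)

definition corner_at :: "nat \<Rightarrow> complex mat \<Rightarrow> bool" where
  "corner_at k D \<longleftrightarrow> D \<in> L \<and> (\<forall>i\<le>k. \<forall>j\<le>k. G (Suc k) D $$ (i,j) = (if i = k \<and> j = k then 1 else 0))"

lemma corner_effect:
  assumes A: "A \<in> L" and D: "corner_at k D"
  shows "G k (A + complex_of_real x \<cdot>\<^sub>m D) = G k A"
    and "det (G (Suc k) (A + complex_of_real x \<cdot>\<^sub>m D)) = det (G (Suc k) A) + of_real x * det (G k A)"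
    and "det (G k A) \<noteq> 0 \<Longrightarrow> schur_ratio k (A + complex_of_real x \<cdot>\<^sub>m D) = schur_ratio k A + x"
proof -
  have DL: "D \<in> L" using D by (simp add: corner_at_def)
  have e: "G (Suc k) (A + complex_of_real x \<cdot>\<^sub>m D)
      = mat (Suc k) (Suc k) (\<lambda>(i,j). G (Suc k) A $$ (i,j) + (if i = k \<and> j = k then of_real x else 0))"
    using D by (intro eq_matI) (auto simp: corner_at_def G_add_smult_index[OF A DL] simp del: index_add_mat)
  show 1: "G k (A + complex_of_real x \<cdot>\<^sub>m D) = G k A"
    unfolding G_leading[of k] e by (intro eq_matI) auto
  show 2: "det (G (Suc k) (A + complex_of_real x \<cdot>\<^sub>m D)) = det (G (Suc k) A) + of_real x * det (G k A)"
    unfolding e det_add_corner[OF gram_carrier] G_leading[of k A] ..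
  show "schur_ratio k (A + complex_of_real x \<cdot>\<^sub>m D) = schur_ratio k A + x" if "det (G k A) \<noteq> 0"
    unfolding schur_ratio_def 1 2 using that by (simp add: add_divide_distrib)
qed

lemma corner_shift_in_S:
  assumes A: "A \<in> S k p q" and D: "corner_at k D"
  shows "A + complex_of_real x \<cdot>\<^sub>m D \<in> S k p q"
  using A corner_effect(1)[OF S_dest(1)[OF A] D] add_smult[OF S_dest(1)[OF A], of D x] D
  by (simp add: S_def corner_at_def)

lemma corner_obtain:
  assumes "k < N"
  obtains D where "corner_at k D"
  using corner[OF assms] unfolding corner_at_def by blast

lemma S_nonempty:
  assumes "k \<le> N" "p + q = k"
  shows "S k p q \<noteq> {}"
  using assms
proof (induction k arbitrary: p q)
  case 0
  then show ?case using S_zero zero by auto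
next
  case (Suc k)
  have k: "k < N" using Suc.prems by simp
  obtain D where D: "corner_at k D"
    using corner_obtain[OF k] by blast
  then have DL: "D \<in> L" by (simp add: corner_at_def)
  show ?case
  proof (cases p)
    case 0
    then obtain q' where q: "q = Suc q'" using Suc.prems by (cases q) auto
    then obtain A where A: "A \<in> S k p q'" using Suc.IH[of p q'] Suc.prems by auto
    let ?A = "A + complex_of_real (- schur_ratio k A - 1) \<cdot>\<^sub>m D"
    have "?A \<in> S k p q'" by (rule corner_shift_in_S[OF A D])
    moreover have "schur_ratio k ?A < 0"
      unfolding corner_effect(3)[OF S_dest(1)[OF A] D S_dest(3)[OF A]] by simp
    ultimately show ?thesis using S_Suc_neg q by blast
  next
    case (Suc p')
    then obtain A where A: "A \<in> S k p' q" using Suc.IH[of p' q] Suc.prems by auto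
    let ?A = "A + complex_of_real (- schur_ratio k A + 1) \<cdot>\<^sub>m D"
    have "?A \<in> S k p' q" by (rule corner_shift_in_S[OF A D])
    moreover have "schur_ratio k ?A > 0"
      unfolding corner_effect(3)[OF S_dest(1)[OF A] D S_dest(3)[OF A]] by simp
    ultimately show ?thesis using S_Suc_pos Suc by blast
  qed
qed

lemma joined_segment:
  assumes A: "A \<in> L" and B: "B \<in> L"
    and T: "T \<subseteq> carrier_mat N N" "\<And>t. t \<in> {0..1} \<Longrightarrow> A + complex_of_real ((1 - t) * a + t * b) \<cdot>\<^sub>m B \<in> T"
  shows "joined N T (A + complex_of_real a \<cdot>\<^sub>m B) (A + complex_of_real b \<cdot>\<^sub>m B)"
proof -
  have "joined N T (A + complex_of_real ((1 - 0) * a + 0 * b) \<cdot>\<^sub>m B) (A + complex_of_real ((1 - 1) * a + 1 * b) \<cdot>\<^sub>m B)"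
    by (rule joinedI[where g = "\<lambda>t. A + complex_of_real ((1 - t) * a + t * b) \<cdot>\<^sub>m B", OF T])
       (simp_all only: entry_continuous[OF A B], auto intro!: continuous_intros)
  then show ?thesis by simp
qed

lemma add_zero_smult: "A \<in> L \<Longrightarrow> B \<in> L \<Longrightarrow> A + complex_of_real 0 \<cdot>\<^sub>m B = A"
  using L_carrier[of A] L_carrier[of B] by (intro eq_matI) auto

lemma det_G_segment_continuous:
  assumes "A \<in> L" "B \<in> L"
  shows "continuous_on X (\<lambda>t. det (G k (A + complex_of_real t \<cdot>\<^sub>m B)))"
  by (rule det_continuous[OF gram_carrier])
     (simp only: G_add_smult_index[OF assms], intro continuous_intros)

text \<open>
  On a segment whose Gram matrices are nonsingular the signature is constant.
\<close>

lemma nonsingular_segment: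
  assumes A: "A \<in> L" and B: "B \<in> L" and s: "s \<in> {a..b}" "A + complex_of_real s \<cdot>\<^sub>m B \<in> S k p q"
    and ns: "\<And>t. t \<in> {a..b} \<Longrightarrow> det (G k (A + complex_of_real t \<cdot>\<^sub>m B)) \<noteq> 0"
  shows "\<And>t. t \<in> {a..b} \<Longrightarrow> A + complex_of_real t \<cdot>\<^sub>m B \<in> S k p q"
    and "\<And>t u. t \<in> {a..b} \<Longrightarrow> u \<in> {a..b} \<Longrightarrow>
           joined N (S k p q) (A + complex_of_real t \<cdot>\<^sub>m B) (A + complex_of_real u \<cdot>\<^sub>m B)"
proof -
  have inL: "A + complex_of_real t \<cdot>\<^sub>m B \<in> L" for t using add_smult[OF A B] .
  show 1: "A + complex_of_real t \<cdot>\<^sub>m B \<in> S k p q" if t: "t \<in> {a..b}" for t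
  proof -
    have "has_inertia k p q (G k (A + complex_of_real t \<cdot>\<^sub>m B))"
    proof (rule has_inertia_along_path[where M = "\<lambda>t. G k (A + complex_of_real t \<cdot>\<^sub>m B)", OF _ gram_carrier _ ns s(1) t])
      show "continuous_on {a..b} (\<lambda>t. G k (A + complex_of_real t \<cdot>\<^sub>m B) $$ (i,j))" if "i < k" "j < k" for i j
        unfolding G_add_smult_index[OF A B that] by (intro continuous_intros)
    qed (use G_hermitian[OF inL] S_dest(2)[OF s(2)] in auto)
    then show ?thesis using inL by (simp add: S_def)
  qed
  fix t u assume tu: "t \<in> {a..b}" "u \<in> {a..b}"
  show "joined N (S k p q) (A + complex_of_real t \<cdot>\<^sub>m B) (A + complex_of_real u \<cdot>\<^sub>m B)"
  proof (rule joined_segment[OF A B S_carrier 1])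
    fix v :: real assume "v \<in> {0..1}"
    then show "(1 - v) * t + v * u \<in> {a..b}"
      using tu convexD_alt[of "{a..b}" t u v] by auto
  qed
qed

text \<open>
  A path in \<open>S k p q\<close> need not keep the sign of the Schur complement, but this quantity is bounded along
  the path. So first push both end points, and then the whole path, in the direction of the corner form by
  an amount exceeding the bound.
\<close>

lemma joined_same_sign:
  assumes k: "k < N" and sg: "\<sigma> = 1 \<or> \<sigma> = (-1::real)" and j: "joined N (S k p q) A B"
    and r: "\<sigma> * schur_ratio k A > 0" "\<sigma> * schur_ratio k B > 0"
    and T: "T \<subseteq> carrier_mat N N" "\<And>M. M \<in> S k p q \<Longrightarrow> \<sigma> * schur_ratio k M > 0 \<Longrightarrow> M \<in> T"
  shows "joined N T A B"
proof -
  obtain D where D: "corner_at k D"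
    using corner_obtain[OF k] by blast
  then have DL: "D \<in> L" by (simp add: corner_at_def)
  have ss: "\<sigma> * \<sigma> = 1" using sg by auto
  have mem: "M + complex_of_real (\<sigma> * x) \<cdot>\<^sub>m D \<in> T" if M: "M \<in> S k p q" and x: "\<sigma> * schur_ratio k M + x > 0" for M x
  proof (rule T(2))
    show "M + complex_of_real (\<sigma> * x) \<cdot>\<^sub>m D \<in> S k p q" by (rule corner_shift_in_S[OF M D])
    have sx: "\<sigma> * (\<sigma> * x) = x" using ss by (simp flip: mult.assoc)
    show "\<sigma> * schur_ratio k (M + complex_of_real (\<sigma> * x) \<cdot>\<^sub>m D) > 0"
      unfolding corner_effect(3)[OF S_dest(1)[OF M] D S_dest(3)[OF M]] distrib_left sx using x .
  qed
  obtain g :: "real \<Rightarrow> complex mat" where g: "\<And>t. t \<in> {0..1} \<Longrightarrow> g t \<in> S k p q" "g 0 = A" "g 1 = B"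
    "\<And>i j. i < N \<Longrightarrow> j < N \<Longrightarrow> continuous_on {0..1} (\<lambda>t. g t $$ (i,j))"
    by (rule joinedE[OF j]) (rule that)
  have dc: "continuous_on {0..1} (\<lambda>t. det (G l (g t)))" for l
    by (rule det_continuous[OF gram_carrier]) (rule gram_entry_continuous[OF g(4)])
  have "continuous_on {0..1} (\<lambda>t. schur_ratio k (g t))"
    unfolding schur_ratio_def using dc S_dest(3)[OF g(1)] by (intro continuous_intros) auto
  then have "compact ((\<lambda>t. schur_ratio k (g t)) ` {0..1})"
    by (rule compact_continuous_image) simp
  from compact_imp_bounded[OF this] obtain X where "\<forall>x\<in>(\<lambda>t. schur_ratio k (g t)) ` {0..1}. norm x \<le> X"
    unfolding bounded_iff by blast
  then have X: "\<bar>schur_ratio k (g t)\<bar> \<le> X" if "t \<in> {0..1}" for t using that by simp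
  define Y where "Y = X + 1"
  have Y: "Y > 0" "\<And>t. t \<in> {0..1} \<Longrightarrow> \<sigma> * schur_ratio k (g t) + Y > 0"
  proof -
    show "Y > 0" using X[of 0] by (simp add: Y_def)
    show "\<sigma> * schur_ratio k (g t) + Y > 0" if "t \<in> {0..1}" for t
      using X[OF that] sg by (auto simp: Y_def)
  qed
  have push: "joined N T M (M + complex_of_real (\<sigma> * Y) \<cdot>\<^sub>m D)"
    if M: "M \<in> S k p q" and rM: "\<sigma> * schur_ratio k M > 0" for M
  proof -
    have "joined N T (M + complex_of_real 0 \<cdot>\<^sub>m D) (M + complex_of_real (\<sigma> * Y) \<cdot>\<^sub>m D)"
    proof (rule joined_segment[OF S_dest(1)[OF M] DL T(1)])
      fix t :: real assume "t \<in> {0..1}"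
      then have "0 \<le> t * Y" using Y by simp
      then have "M + complex_of_real (\<sigma> * (t * Y)) \<cdot>\<^sub>m D \<in> T" using mem[OF M, of "t * Y"] rM by simp
      then show "M + complex_of_real ((1 - t) * 0 + t * (\<sigma> * Y)) \<cdot>\<^sub>m D \<in> T"
        by (simp only: mult_zero_right add_0 mult.left_commute)
    qed
    then show ?thesis unfolding add_zero_smult[OF S_dest(1)[OF M] DL] .
  qed
  have "joined N T (g 0 + complex_of_real (\<sigma> * Y) \<cdot>\<^sub>m D) (g 1 + complex_of_real (\<sigma> * Y) \<cdot>\<^sub>m D)"
  proof (rule joinedI[where g = "\<lambda>t. g t + complex_of_real (\<sigma> * Y) \<cdot>\<^sub>m D", OF T(1)])
    fix i j assume ij: "i < N" "j < N"
    have "continuous_on {0..1} (\<lambda>t. g t $$ (i,j) + complex_of_real (\<sigma> * Y) * D $$ (i,j))"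
      by (intro continuous_intros g(4) ij)
    then show "continuous_on {0..1} (\<lambda>t. (g t + complex_of_real (\<sigma> * Y) \<cdot>\<^sub>m D) $$ (i,j))"
      by (rule continuous_on_eq) (use L_carrier[OF DL] ij in auto)
  qed (use mem[OF g(1)] Y in auto)
  then have "joined N T (A + complex_of_real (\<sigma> * Y) \<cdot>\<^sub>m D) (B + complex_of_real (\<sigma> * Y) \<cdot>\<^sub>m D)"
    by (simp add: g)
  then show ?thesis
    using push[of A] push[of B] joined_in[OF j] r joined_trans joined_sym by meson
qed

lemma det_nonzero_nearby:
  assumes A: "A \<in> L" and B: "B \<in> L" and d: "det (G k A) \<noteq> 0"
  shows "\<exists>e>0. \<forall>t\<in>{-e..e}. det (G k (A + complex_of_real t \<cdot>\<^sub>m B)) \<noteq> 0"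
proof -
  have "isCont (\<lambda>t. det (G k (A + complex_of_real t \<cdot>\<^sub>m B))) 0"
    using det_G_segment_continuous[OF A B, of UNIV k] by (simp add: continuous_on_eq_continuous_at)
  then have "eventually (\<lambda>t. det (G k (A + complex_of_real t \<cdot>\<^sub>m B)) \<noteq> 0) (at 0)"
    using d add_zero_smult[OF A B] by (intro tendsto_imp_eventually_ne) (auto simp: isCont_def)
  then obtain e where e: "e > 0" "\<And>t. t \<noteq> 0 \<Longrightarrow> dist t 0 < e \<Longrightarrow> det (G k (A + complex_of_real t \<cdot>\<^sub>m B)) \<noteq> 0"
    by (auto simp: eventually_at)
  show ?thesis
  proof (intro exI[of _ "e/2"] conjI ballI)
    fix t assume t: "t \<in> {-(e/2)..e/2}"
    show "det (G k (A + complex_of_real t \<cdot>\<^sub>m B)) \<noteq> 0"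
    proof (cases "t = 0")
      case True
      then show ?thesis using d add_zero_smult[OF A B] by simp
    next
      case False
      then show ?thesis using e t by (intro e(2)) (auto simp: dist_real_def)
    qed
  qed (use e in simp)
qed

text \<open>
  Perturb in the direction of a form \<open>E\<close> with nonsingular \<open>G k E\<close>.
\<close>

lemma joined_to_nonsingular_leading:
  assumes k: "k < N" and A: "A \<in> S (Suc k) p q"
  obtains A' where "joined N (S (Suc k) p q) A A'" "det (G k A') \<noteq> 0"
proof -
  obtain E where E: "E \<in> S k k 0" using S_nonempty[of k k 0] k by auto
  note EL = S_dest(1)[OF E] and AL = S_dest(1)[OF A]
  obtain e where e: "e > 0" "\<forall>t\<in>{-e..e}. det (G (Suc k) (A + complex_of_real t \<cdot>\<^sub>m E)) \<noteq> 0"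
    using det_nonzero_nearby[OF AL EL S_dest(3)[OF A]] by blast
  obtain t where t: "0 < t" "t < e" "det (G k A + complex_of_real t \<cdot>\<^sub>m G k E) \<noteq> 0"
    using det_perturbation_nonzero[OF gram_carrier gram_carrier S_dest(3)[OF E] e(1)] by blast
  have A0: "A + complex_of_real 0 \<cdot>\<^sub>m E = A" using add_zero_smult[OF AL EL] .
  have "joined N (S (Suc k) p q) (A + complex_of_real 0 \<cdot>\<^sub>m E) (A + complex_of_real t \<cdot>\<^sub>m E)"
    by (rule nonsingular_segment(2)[OF AL EL, of 0 "-e" e]) (use A A0 e t in auto)
  then show ?thesis using that t(3) unfolding A0 G_add_smult[OF AL EL, symmetric] by blast
qed

text \<open>
  The corner form is used to make \<open>G (Suc j)\<close> singular, and the off-corner form \<open>F\<close> to keep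
  \<open>G (Suc (Suc j))\<close> nonsingular.
\<close>

lemma exists_singular_leading:
  assumes k: "Suc j < N" and A: "A \<in> S j p q"
  obtains B where "B \<in> S j p q" "det (G (Suc j) B) = 0" "det (G (Suc (Suc j)) B) \<noteq> 0"
proof -
  obtain D where D: "corner_at j D"
    using corner_obtain[of j] k by auto
  then have DL: "D \<in> L" by (simp add: corner_at_def)
  note AL = S_dest(1)[OF A]
  have j: "j < N" using k by simp
  define x where "x = - Re (det (G (Suc j) A)) / Re (det (G j A))"
  define B0 where "B0 = A + complex_of_real x \<cdot>\<^sub>m D"
  have B0: "B0 \<in> S j p q" unfolding B0_def by (rule corner_shift_in_S[OF A D])
  note BL = S_dest(1)[OF B0]
  have dB0: "det (G (Suc j) B0) = 0"
  proof -
    have "Re (det (G j A)) \<noteq> 0" using S_dest(3)[OF A] det_G_real[OF AL, of j] by (metis of_real_0)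
    then have "complex_of_real (Re (det (G (Suc j) A)) + x * Re (det (G j A))) = 0" by (simp add: x_def)
    then show ?thesis unfolding B0_def corner_effect(2)[OF AL D]
      using det_G_real[OF AL, of j] det_G_real[OF AL, of "Suc j"] by (metis of_real_add of_real_mult)
  qed
  obtain F where F: "F \<in> L" "\<And>i l. i \<le> j \<Longrightarrow> l \<le> j \<Longrightarrow> G (Suc (Suc j)) F $$ (i,l) = 0"
    "\<And>i. i < j \<Longrightarrow> G (Suc (Suc j)) F $$ (i, Suc j) = 0" "G (Suc (Suc j)) F $$ (j, Suc j) \<noteq> 0"
    using off_corner[OF k] by blast
  obtain u where u: "\<exists>i<Suc j. u i \<noteq> 0" "\<And>r. r < Suc j \<Longrightarrow> (\<Sum>s<Suc j. G (Suc j) B0 $$ (r,s) * u s) = 0"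
    using exists_kernel_function[OF gram_carrier dB0] by blast
  have uj: "u j \<noteq> 0"
  proof
    assume z: "u j = 0"
    have "u i = 0" if i: "i < j" for i
    proof (rule kernel_trivial[OF gram_carrier S_dest(3)[OF B0] _ i])
      fix r assume r: "r < j"
      then show "(\<Sum>s<j. G j B0 $$ (r,s) * u s) = 0"
        using u(2)[of r] z by (simp add: gram_index)
    qed
    then show False using u(1) z by (auto simp: less_Suc_eq)
  qed
  let ?B = "\<lambda>z. B0 + complex_of_real z \<cdot>\<^sub>m F"
  let ?c = "\<lambda>z. \<Sum>r<Suc j. cnj (u r) * G (Suc (Suc j)) (?B z) $$ (r, Suc j)"
  have BzL: "?B z \<in> L" for z using add_smult[OF BL F(1)] .
  have lead: "G (Suc j) (?B z) = G (Suc j) B0" for z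
    unfolding G_leading[of "Suc j"]
    by (intro eq_matI) (auto simp: G_add_smult_index[OF BL F(1)] F(2) simp del: index_add_mat)
  have c: "?c z = ?c 0 + complex_of_real z * (cnj (u j) * G (Suc (Suc j)) F $$ (j, Suc j))" for z
    by (simp add: G_add_smult_index[OF BL F(1)] F(3) algebra_simps del: index_add_mat)
  \<comment> \<open>\<open>?c\<close> is a nonconstant affine function, so it cannot vanish at both 0 and 1\<close>
  have "\<exists>z. ?c z \<noteq> 0"
  proof (rule ccontr)
    assume "\<not> ?thesis"
    then have "?c 0 = 0" "?c 1 = 0" by blast+
    then show False using c[of 1] uj F(4) by (simp del: sum.lessThan_Suc)
  qed
  then obtain z where z: "?c z \<noteq> 0" by blast
  have leadj: "G j (?B z) = G j B0" unfolding G_leading[of j] lead ..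
  have "det (G (Suc (Suc j)) (?B z)) \<noteq> 0"
  proof (rule double_border_nonsingular[OF gram_carrier G_hermitian[OF BzL] _ _ uj z])
    have "mat j j (\<lambda>ij. G (Suc (Suc j)) (?B z) $$ ij) = G j (?B z)"
      by (intro eq_matI) (auto simp: gram_index)
    then show "det (mat j j (\<lambda>ij. G (Suc (Suc j)) (?B z) $$ ij)) \<noteq> 0"
      using S_dest(3)[OF B0] leadj by simp
    fix r assume r: "r < Suc j"
    have "G (Suc (Suc j)) (?B z) $$ (r,s) = G (Suc j) B0 $$ (r,s)" if "s < Suc j" for s
      unfolding lead[of z, symmetric] using r that by (simp add: gram_index)
    then show "(\<Sum>s<Suc j. G (Suc (Suc j)) (?B z) $$ (r,s) * u s) = 0"
      using u(2)[OF r] by (simp del: sum.lessThan_Suc)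
  qed
  moreover have "?B z \<in> S j p q" using BzL S_dest(2)[OF B0] leadj by (simp add: S_def)
  ultimately show ?thesis using that dB0 lead by metis
qed

text \<open>
  Through \<open>B\<close> the determinant of \<open>G (Suc j)\<close> changes sign along the corner form, while
  \<open>G (Suc (Suc j))\<close> stays nonsingular. The common signature of the latter on the two sides is found by
  counting from both ends: from \<open>(p + 1, q)\<close> one reaches \<open>(p + 2, q)\<close> or \<open>(p + 1, q + 1)\<close>, and from
  \<open>(p, q + 1)\<close> one reaches \<open>(p + 1, q + 1)\<close> or \<open>(p, q + 2)\<close>.
\<close>

lemma sign_swap:
  assumes k: "Suc j < N" and pq: "p + q = j"
  obtains U V where "joined N (S (Suc (Suc j)) (Suc p) (Suc q)) U V"
    "U \<in> S (Suc j) (Suc p) q" "V \<in> S (Suc j) p (Suc q)"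
proof -
  have j: "j < N" using k by simp
  obtain A where "A \<in> S j p q" using S_nonempty[of j p q] j pq by auto
  from exists_singular_leading[OF k this] obtain B where
    B: "B \<in> S j p q" "det (G (Suc j) B) = 0" "det (G (Suc (Suc j)) B) \<noteq> 0" by blast
  note BL = S_dest(1)[OF B(1)]
  obtain D where D: "corner_at j D"
    using corner_obtain[OF j] by blast
  then have DL: "D \<in> L" by (simp add: corner_at_def)
  obtain e where e: "e > 0" "\<forall>t\<in>{-e..e}. det (G (Suc (Suc j)) (B + complex_of_real t \<cdot>\<^sub>m D)) \<noteq> 0"
    using det_nonzero_nearby[OF BL DL B(3)] by blast
  let ?B = "\<lambda>t. B + complex_of_real t \<cdot>\<^sub>m D"
  have BtL: "?B t \<in> L" for t using add_smult[OF BL DL] .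
  have r0: "schur_ratio j B = 0" by (simp add: schur_ratio_def B(2))
  have Bj: "?B t \<in> S j p q" "schur_ratio j (?B t) = t" for t
    using corner_shift_in_S[OF B(1) D] corner_effect(3)[OF BL D S_dest(3)[OF B(1)]] r0 by simp_all
  have U: "?B e \<in> S (Suc j) (Suc p) q" using S_Suc_pos[OF Bj(1)] Bj(2) e by simp
  have V: "?B (-e) \<in> S (Suc j) p (Suc q)" by (rule S_Suc_neg[OF Bj(1)]) (simp only: Bj(2), use e in simp)
  obtain P Q where PQ: "?B e \<in> S (Suc (Suc j)) P Q"
    using in_S[OF BtL[of e], of "Suc (Suc j)"] e by auto
  have jn: "joined N (S (Suc (Suc j)) P Q) (?B e) (?B (-e))"
    by (rule nonsingular_segment(2)[OF BL DL _ PQ, of "-e" e]) (use e in auto)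
  have PQ': "?B (-e) \<in> S (Suc (Suc j)) P Q" using joined_in(2)[OF jn] .
  have 1: "?B e \<in> S (Suc (Suc j)) (Suc (Suc p)) q \<or> ?B e \<in> S (Suc (Suc j)) (Suc p) (Suc q)"
    using S_Suc_pos[OF U] S_Suc_neg[OF U] schur_ratio_nonzero[OF BtL S_dest(3)[OF U] S_dest(3)[OF PQ]]
    by (meson linorder_neqE_linordered_idom)
  have 2: "?B (-e) \<in> S (Suc (Suc j)) (Suc p) (Suc q) \<or> ?B (-e) \<in> S (Suc (Suc j)) p (Suc (Suc q))"
    using S_Suc_pos[OF V] S_Suc_neg[OF V] schur_ratio_nonzero[OF BtL S_dest(3)[OF V] S_dest(3)[OF PQ']]
    by (meson linorder_neqE_linordered_idom)
  have "P = Suc (Suc p) \<and> Q = q \<or> P = Suc p \<and> Q = Suc q" using 1 S_unique[OF PQ] by blast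
  moreover have "P = Suc p \<and> Q = Suc q \<or> P = p \<and> Q = Suc (Suc q)" using 2 S_unique[OF PQ'] by blast
  ultimately have "P = Suc p \<and> Q = Suc q" by auto
  then show ?thesis using that[OF _ U V] jn by simp
qed

text \<open>
  Induction on \<open>k\<close>. After a perturbation both end points have nonsingular \<open>G k\<close>, and each of them is
  of one of two types, according to the signature of \<open>G k\<close>. Points of the same type are joined by the
  induction hypothesis and \<open>joined_same_sign\<close>, points of different type via \<open>sign_swap\<close>.
\<close>

theorem S_joined:
  assumes "k \<le> N" "A \<in> S k p q" "B \<in> S k p q"
  shows "joined N (S k p q) A B"
  using assms
proof (induction k arbitrary: p q A B)
  case 0
  then have pq: "p = 0" "q = 0" using S_sum by auto
  have AB: "A \<in> L" "B \<in> L" using 0 S_dest by auto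
  have "(-1::complex) = complex_of_real (-1)" by simp
  then have BA: "B + (-1) \<cdot>\<^sub>m A \<in> L" using add_smult[OF AB(2,1), of "-1"] by simp
  have "joined N L (A + complex_of_real 0 \<cdot>\<^sub>m (B + (-1) \<cdot>\<^sub>m A)) (A + complex_of_real 1 \<cdot>\<^sub>m (B + (-1) \<cdot>\<^sub>m A))"
    by (rule joined_segment[OF AB(1) BA carrier]) (rule add_smult[OF AB(1) BA])
  moreover have "A + complex_of_real 1 \<cdot>\<^sub>m (B + (-1) \<cdot>\<^sub>m A) = B"
    using L_carrier[OF AB(1)] L_carrier[OF AB(2)] by (intro eq_matI) auto
  ultimately show ?case using add_zero_smult[OF AB(1) BA] unfolding pq S_zero by simp
next
  case (Suc k)
  let ?T = "S (Suc k) p q"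
  have k: "k < N" using Suc.prems by simp
  have same: "joined N ?T M M'"
    if "M \<in> ?T" "M' \<in> ?T" "M \<in> S k p' q'" "M' \<in> S k p' q'" for M M' p' q'
  proof -
    have jj: "joined N (S k p' q') M M'" using Suc.IH[of M p' q' M'] that k by simp
    note r = schur_ratio_nonzero[OF S_dest(1)[OF that(1)] S_dest(3)[OF that(3)] S_dest(3)[OF that(1)]]
      schur_ratio_nonzero[OF S_dest(1)[OF that(2)] S_dest(3)[OF that(4)] S_dest(3)[OF that(2)]]
    show ?thesis
    proof (cases "schur_ratio k M > 0")
      case True
      then have pq: "p = Suc p'" "q = q'" using S_Suc_pos[OF that(3)] S_unique[OF that(1)] by blast+
      then have "schur_ratio k M' > 0"
        using r S_Suc_neg[OF that(4)] S_unique[OF that(2)] by (metis linorder_neqE_linordered_idom n_not_Suc_n)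
      then show ?thesis
        using joined_same_sign[OF k _ jj _ _ S_carrier, of 1 "Suc k" p q] True S_Suc_pos pq by auto
    next
      case False
      then have rM: "schur_ratio k M < 0" using r by linarith
      then have pq: "p = p'" "q = Suc q'" using S_Suc_neg[OF that(3)] S_unique[OF that(1)] by blast+
      then have "schur_ratio k M' < 0"
        using r S_Suc_pos[OF that(4)] S_unique[OF that(2)] by (metis linorder_neqE_linordered_idom n_not_Suc_n)
      then show ?thesis
        using joined_same_sign[OF k _ jj _ _ S_carrier, of "-1" "Suc k" p q] rM S_Suc_neg pq by auto
    qed
  qed
  have type: "(\<exists>p'. p = Suc p' \<and> M \<in> S k p' q) \<or> (\<exists>q'. q = Suc q' \<and> M \<in> S k p q')"
    if M: "M \<in> ?T" and d: "det (G k M) \<noteq> 0" for M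
  proof -
    obtain p' q' where M': "M \<in> S k p' q'" using in_S[OF S_dest(1)[OF M] d] by blast
    from schur_ratio_nonzero[OF S_dest(1)[OF M] d S_dest(3)[OF M]]
    consider "schur_ratio k M > 0" | "schur_ratio k M < 0" by linarith
    then show ?thesis
    proof cases
      case 1
      then show ?thesis using S_Suc_pos[OF M'] S_unique[OF M] M' by blast
    next
      case 2
      then show ?thesis using S_Suc_neg[OF M'] S_unique[OF M] M' by blast
    qed
  qed
  have mixed: "joined N ?T M M'"
    if M: "M \<in> ?T" "M' \<in> ?T" and t: "p = Suc p'" "M \<in> S k p' q" "q = Suc q'" "M' \<in> S k p q'" for M M' p' q'
  proof -
    have s: "p' + Suc q' = k" using S_sum[OF t(2)] t(3) by simp
    then obtain j where j: "k = Suc j" "p' + q' = j" by (cases k) auto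
    obtain U V where UV: "joined N (S (Suc (Suc j)) (Suc p') (Suc q')) U V"
      "U \<in> S (Suc j) (Suc p') q'" "V \<in> S (Suc j) p' (Suc q')"
      by (rule sign_swap[of j p' q']) (use k j in auto)
    have UV': "joined N ?T U V" "U \<in> S k p q'" "V \<in> S k p' q" using UV j t by auto
    have "joined N ?T M V" using same[OF M(1) joined_in(2)[OF UV'(1)] t(2) UV'(3)] .
    moreover have "joined N ?T U M'" using same[OF joined_in(1)[OF UV'(1)] M(2) UV'(2) t(4)] .
    ultimately show ?thesis using UV'(1) joined_sym joined_trans by meson
  qed
  have all: "joined N ?T M M'" if M: "M \<in> ?T" "M' \<in> ?T" "det (G k M) \<noteq> 0" "det (G k M') \<noteq> 0" for M M'
    using type[OF M(1,3)] type[OF M(2,4)]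
  proof (elim disjE exE conjE)
    fix p' p'' assume "p = Suc p'" "M \<in> S k p' q" "p = Suc p''" "M' \<in> S k p'' q"
    then show ?thesis using same[OF M(1,2)] by blast
  next
    fix p' q' assume "p = Suc p'" "M \<in> S k p' q" "q = Suc q'" "M' \<in> S k p q'"
    then show ?thesis using mixed[OF M(1,2)] by blast
  next
    fix q' p' assume "q = Suc q'" "M \<in> S k p q'" "p = Suc p'" "M' \<in> S k p' q"
    then show ?thesis using mixed[OF M(2,1)] joined_sym by blast
  next
    fix q' q'' assume "q = Suc q'" "M \<in> S k p q'" "q = Suc q''" "M' \<in> S k p q''"
    then show ?thesis using same[OF M(1,2)] by blast
  qed
  obtain A' where A': "joined N ?T A A'" "det (G k A') \<noteq> 0"
    using joined_to_nonsingular_leading[OF k Suc.prems(2)] by blast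
  obtain B' where B': "joined N ?T B B'" "det (G k B') \<noteq> 0"
    using joined_to_nonsingular_leading[OF k Suc.prems(3)] by blast
  have "joined N ?T A' B'" using all joined_in(2)[OF A'(1)] joined_in(2)[OF B'(1)] A'(2) B'(2) by blast
  then show ?case using A'(1) B'(1) joined_sym joined_trans by meson
qed

end

section \<open>Congruence, and Toeplitz forms at a zero of a polynomial\<close>

lemma invertible_mat_iff_det:
  fixes A :: "complex mat"
  assumes A: "A \<in> carrier_mat n n"
  shows "invertible_mat A \<longleftrightarrow> det A \<noteq> 0"
proof
  assume "invertible_mat A"
  then obtain B where B: "A * B = 1\<^sub>m n" "B * A = 1\<^sub>m (dim_row B)"
    using A by (auto simp: invertible_mat_def inverts_mat_def)
  have "dim_row B = dim_col (B * A)" using B(2) by simp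
  then have "B \<in> carrier_mat n n"
    using A arg_cong[OF B(1), of dim_col] by (intro carrier_matI) auto
  then have "det A * det B = 1" using det_mult[OF A, of B] B(1) by simp
  then show "det A \<noteq> 0" by auto
next
  assume "det A \<noteq> 0"
  from det_non_zero_imp_unit[OF A this] obtain B where
    "B \<in> carrier_mat n n" "B * A = 1\<^sub>m n" "A * B = 1\<^sub>m n"
    by (auto simp: Units_def ring_mat_def)
  then show "invertible_mat A" using A by (auto simp: invertible_mat_def inverts_mat_def)
qed

lemma gram_eq_mult:
  assumes C: "C \<in> carrier_mat n n" and A: "A \<in> carrier_mat n n"
  shows "gram n C n A = mat_adjoint C * (A * C)"
  using C A mat_adjoint_carrier[OF C]
  by (intro eq_matI)
     (auto simp: gram_index scalar_prod_def atLeast0LessThan mat_adjoint_index[OF C] sum_distrib_left mult_ac)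

lemma det_mat_adjoint_nonzero:
  fixes C :: "complex mat"
  assumes C: "C \<in> carrier_mat n n" and d: "det C \<noteq> 0"
  shows "det (mat_adjoint C) \<noteq> 0"
proof -
  from det_non_zero_imp_unit[OF C d] obtain B where
    B: "B \<in> carrier_mat n n" "B * C = 1\<^sub>m n" by (auto simp: Units_def ring_mat_def)
  have "mat_adjoint C * mat_adjoint B = mat_adjoint (1\<^sub>m n)"
    using mat_adjoint_mult[OF B(1) C] B(2) by simp
  also have "\<dots> = 1\<^sub>m n" by (rule hermitianI) auto
  finally have "det (mat_adjoint C) * det (mat_adjoint B) = 1"
    using det_mult[OF mat_adjoint_carrier[OF C] mat_adjoint_carrier[OF B(1)]] by simp
  then show ?thesis by auto
qed

theorem has_inertia_congruence:
  assumes C: "C \<in> carrier_mat n n" "det C \<noteq> 0" and A: "A \<in> carrier_mat n n" "mat_adjoint A = A"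
  shows "has_inertia n p q (gram n C n A) \<longleftrightarrow> has_inertia n p q A"
proof -
  have dg: "det (gram n C n A) = det (mat_adjoint C) * (det A * det C)"
    unfolding gram_eq_mult[OF C(1) A(1)]
    using det_mult[OF mat_adjoint_carrier[OF C(1)] mult_carrier_mat[OF A(1) C(1)]] det_mult[OF A(1) C(1)] by simp
  have *: "has_inertia n p q A" if h: "has_inertia n p q (gram n C n A)" for p q
  proof -
    from h obtain P d where P: "P \<in> carrier_mat n n" "gram n P n (gram n C n A) = real_diag_mat n d"
      and d: "\<And>k. k < n \<Longrightarrow> d k \<noteq> 0" and p: "card {k. k < n \<and> d k > 0} = p" "card {k. k < n \<and> d k < 0} = q"
      by (rule has_inertia_basis) (rule that; assumption)
    have g: "qform n (gram n (C * P) n A) c = of_real (\<Sum>k<n. d k * (cmod (c k))\<^sup>2)" for c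
    proof -
      have e: "(\<Sum>i<n. (C * P) $$ (r,i) * c i) = (\<Sum>l<n. C $$ (r,l) * (\<Sum>i<n. P $$ (l,i) * c i))" if r: "r < n" for r
      proof -
        have "(\<Sum>i<n. (C * P) $$ (r,i) * c i) = (\<Sum>i<n. \<Sum>l<n. C $$ (r,l) * (P $$ (l,i) * c i))"
          using C P r by (intro sum.cong refl)
            (simp add: scalar_prod_def atLeast0LessThan sum_distrib_right mult.assoc)
        also have "\<dots> = (\<Sum>l<n. C $$ (r,l) * (\<Sum>i<n. P $$ (l,i) * c i))"
          by (subst sum.swap) (simp add: sum_distrib_left)
        finally show ?thesis .
      qed
      have "qform n (gram n (C * P) n A) c = qform n A (\<lambda>r. \<Sum>l<n. C $$ (r,l) * (\<Sum>i<n. P $$ (l,i) * c i))"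
        unfolding qform_gram unfolding qform_def by (intro sum.cong refl) (simp add: e)
      also have "\<dots> = qform n (real_diag_mat n d) c"
        unfolding P(2)[symmetric] qform_gram ..
      finally show ?thesis unfolding qform_real_diag .
    qed
    have dA: "det A \<noteq> 0" using h dg by (auto simp: has_inertia_def)
    show ?thesis using has_inertiaI_diag[OF A dA g d] unfolding p .
  qed
  show ?thesis
  proof
    assume h: "has_inertia n p q A"
    then have "det (gram n C n A) \<noteq> 0"
      using dg det_mat_adjoint_nonzero[OF C] C(2) by (simp add: has_inertia_def)
    then have "has_inertia n (num_pos_eigenvalues (gram n C n A)) (num_neg_eigenvalues (gram n C n A)) (gram n C n A)"
      using gram_hermitian[OF A] by (simp add: has_inertia_def)
    with *[OF this] h show "has_inertia n p q (gram n C n A)" by (auto simp: has_inertia_def)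
  qed (rule *)
qed

text \<open>
  The value at \<open>z = 1\<close> of the operator \<open>z d/dz\<close> applied \<open>t\<close> times to \<open>P\<close>, provided that
  \<open>degree P < n\<close>. As with derivatives, the order of vanishing at 1 of a nonzero \<open>P\<close> is the least \<open>t\<close> with
  nonzero moment.
\<close>

definition moment :: "nat \<Rightarrow> complex poly \<Rightarrow> nat \<Rightarrow> complex" where
  "moment n P t = (\<Sum>a<n. of_nat a ^ t * coeff P a)"

text \<open>
  Multiplication by \<open>z - 1\<close> replaces \<open>a ^ t\<close> by the difference \<open>(a + 1) ^ t - a ^ t\<close>.
\<close>

lemma moment_mult_root_one:
  assumes "degree R + 1 < n"
  shows "moment n ([:-1, 1:] * R) t = (\<Sum>r<t. of_nat (t choose r) * moment n R r)"
proof -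
  obtain n' where n: "n = Suc n'" using assms by (cases n) auto
  have R: "coeff R n' = 0" using assms n by (intro coeff_eq_0) simp
  have c: "coeff ([:-1, 1:] * R) a = (case a of 0 \<Rightarrow> 0 | Suc b \<Rightarrow> coeff R b) - coeff R a" for a
    by (simp add: coeff_pCons split: nat.splits)
  have "moment n ([:-1, 1:] * R) t
      = (\<Sum>a<n. of_nat a ^ t * (case a of 0 \<Rightarrow> 0 | Suc b \<Rightarrow> coeff R b)) - (\<Sum>a<n. of_nat a ^ t * coeff R a)"
    unfolding moment_def c by (simp add: right_diff_distrib sum_subtractf)
  also have "(\<Sum>a<n. of_nat a ^ t * (case a of 0 \<Rightarrow> 0 | Suc b \<Rightarrow> coeff R b)) = (\<Sum>a<n. of_nat (Suc a) ^ t * coeff R a)"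
    unfolding n by (subst sum.lessThan_Suc_shift) (simp add: R)
  also have "(\<Sum>a<n. of_nat (Suc a) ^ t * coeff R a) - (\<Sum>a<n. of_nat a ^ t * coeff R a)
      = (\<Sum>a<n. \<Sum>r<t. of_nat (t choose r) * (of_nat a ^ r * coeff R a))"
    unfolding sum_subtractf[symmetric]
  proof (rule sum.cong[OF refl])
    fix a
    have "(of_nat (Suc a) :: complex) ^ t = (\<Sum>r\<le>t. of_nat (t choose r) * of_nat a ^ r)"
      using binomial_ring[of "of_nat a :: complex" 1 t] by (simp add: add.commute)
    also have "\<dots> = (\<Sum>r<t. of_nat (t choose r) * of_nat a ^ r) + of_nat a ^ t"
      by (simp add: lessThan_Suc_atMost[symmetric])
    finally show "of_nat (Suc a) ^ t * coeff R a - of_nat a ^ t * coeff R a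
        = (\<Sum>r<t. of_nat (t choose r) * (of_nat a ^ r * coeff R a))"
      by (simp add: algebra_simps sum_distrib_left)
  qed
  also have "\<dots> = (\<Sum>r<t. of_nat (t choose r) * moment n R r)"
    by (subst sum.swap) (simp add: moment_def sum_distrib_left)
  finally show ?thesis .
qed

lemma moment_zero_of_order:
  assumes "degree R + v < n"
  shows "t < v \<Longrightarrow> moment n ([:-1, 1:] ^ v * R) t = 0"
    and "moment n ([:-1, 1:] ^ v * R) v = fact v * moment n R 0"
proof -
  have "(\<forall>t<v. moment n ([:-1, 1:] ^ v * R) t = 0) \<and> moment n ([:-1, 1:] ^ v * R) v = fact v * moment n R 0"
    using assms
  proof (induction v)
    case (Suc v)
    let ?Q = "[:-1, 1:] ^ v * R"
    have "degree ?Q \<le> degree ([:-1, 1:] ^ v :: complex poly) + degree R" by (rule degree_mult_le)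
    also have "degree ([:-1, 1:] ^ v :: complex poly) \<le> v"
      using degree_power_le[of "[:-1, 1:] :: complex poly" v] by simp
    finally have dQ: "degree ?Q + 1 < n" using Suc.prems by simp
    have rec: "moment n ([:-1, 1:] ^ Suc v * R) t = (\<Sum>r<t. of_nat (t choose r) * moment n ?Q r)" for t
      using moment_mult_root_one[OF dQ, of t] by (simp only: power_Suc mult.assoc)
    have IH: "\<forall>t<v. moment n ?Q t = 0" "moment n ?Q v = fact v * moment n R 0"
      using Suc by auto
    have "moment n ([:-1, 1:] ^ Suc v * R) t = 0" if "t < Suc v" for t
      unfolding rec using IH(1) that by (intro sum.neutral) auto
    moreover have "moment n ([:-1, 1:] ^ Suc v * R) (Suc v) = fact (Suc v) * moment n R 0"
      unfolding rec using IH by (simp add: algebra_simps)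
    ultimately show ?case by blast
  qed simp
  then show "t < v \<Longrightarrow> moment n ([:-1, 1:] ^ v * R) t = 0"
    "moment n ([:-1, 1:] ^ v * R) v = fact v * moment n R 0" by auto
qed

text \<open>
  The factor \<open>\<i>\<close> makes the Toeplitz matrix with this symbol hermitian.
\<close>

definition power_symbol :: "nat \<Rightarrow> int \<Rightarrow> complex" where
  "power_symbol s k = (\<i> * of_int k) ^ s"

text \<open>
  The Leibniz rule for the form of order \<open>s\<close>, obtained by expanding \<open>(a - b) ^ s\<close>.
\<close>

lemma power_symbol_form:
  "(\<Sum>a<n. \<Sum>b<n. cnj (coeff P a) * power_symbol s (int a - int b) * coeff Q b)
     = \<i> ^ s * (\<Sum>t\<le>s. of_nat (s choose t) * (-1) ^ (s - t) * cnj (moment n P t) * moment n Q (s - t))"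
proof -
  have "power_symbol s (int a - int b)
      = \<i> ^ s * (\<Sum>t\<le>s. of_nat (s choose t) * (-1) ^ (s - t) * of_nat a ^ t * of_nat b ^ (s - t))" for a b
    using binomial_ring[of "of_nat a :: complex" "- of_nat b" s]
    by (simp add: power_symbol_def power_mult_distrib power_minus[of "of_nat b"] mult_ac)
  then have "(\<Sum>a<n. \<Sum>b<n. cnj (coeff P a) * power_symbol s (int a - int b) * coeff Q b)
      = (\<Sum>a<n. \<Sum>b<n. \<Sum>t\<le>s. \<i> ^ s * (of_nat (s choose t) * (-1) ^ (s - t) * (of_nat a ^ t * cnj (coeff P a)) * (of_nat b ^ (s - t) * coeff Q b)))"
    by (simp add: sum_distrib_left sum_distrib_right mult_ac)
  also have "\<dots> = (\<Sum>t\<le>s. \<Sum>a<n. \<Sum>b<n. \<i> ^ s * (of_nat (s choose t) * (-1) ^ (s - t) * (of_nat a ^ t * cnj (coeff P a)) * (of_nat b ^ (s - t) * coeff Q b)))"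
    by (subst (2) sum.swap, subst sum.swap) simp
  also have "\<dots> = \<i> ^ s * (\<Sum>t\<le>s. of_nat (s choose t) * (-1) ^ (s - t) * cnj (moment n P t) * moment n Q (s - t))"
    by (simp add: moment_def sum_distrib_left sum_distrib_right mult_ac)
  finally show ?thesis .
qed

text \<open>
  The order of vanishing at 1 decreases with \<open>j\<close>, so a Toeplitz form given by derivatives at 1
  vanishes on an initial part of the flag; the order of vanishing at 0 increases, which makes the matrix of
  coefficients triangular.
\<close>

definition flag_poly :: "nat \<Rightarrow> nat \<Rightarrow> complex poly" where
  "flag_poly n j = [:-1, 1:] ^ (n - 1 - j) * monom 1 j"

definition symbol_form :: "nat \<Rightarrow> nat \<Rightarrow> nat \<Rightarrow> nat \<Rightarrow> complex" where
  "symbol_form n s i j = (\<Sum>a<n. \<Sum>b<n. cnj (coeff (flag_poly n i) a) * power_symbol s (int a - int b) * coeff (flag_poly n j) b)"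

lemma flag_moment:
  assumes "j < n"
  shows "t < n - 1 - j \<Longrightarrow> moment n (flag_poly n j) t = 0"
    and "moment n (flag_poly n j) (n - 1 - j) = fact (n - 1 - j)"
proof -
  have d: "degree (monom 1 j :: complex poly) + (n - 1 - j) < n" using assms by (simp add: degree_monom_eq)
  have m: "moment n (monom 1 j) 0 = 1" using assms by (simp add: moment_def)
  show "t < n - 1 - j \<Longrightarrow> moment n (flag_poly n j) t = 0"
    unfolding flag_poly_def by (rule moment_zero_of_order(1)[OF d])
  show "moment n (flag_poly n j) (n - 1 - j) = fact (n - 1 - j)"
    unfolding flag_poly_def moment_zero_of_order(2)[OF d] m by simp
qed

lemma symbol_form_zero:
  assumes "i < n" "j < n" "s < (n - 1 - i) + (n - 1 - j)"
  shows "symbol_form n s i j = 0"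
proof -
  have "moment n (flag_poly n i) t = 0 \<or> moment n (flag_poly n j) (s - t) = 0" if "t \<le> s" for t
    using flag_moment(1)[OF assms(1), of t] flag_moment(1)[OF assms(2), of "s - t"] assms(3) that by linarith
  then show ?thesis
    unfolding symbol_form_def power_symbol_form by (auto intro!: sum.neutral)
qed

lemma symbol_form_leading:
  assumes i: "i < n" and j: "j < n" and s: "s = (n - 1 - i) + (n - 1 - j)"
  shows "symbol_form n s i j = \<i> ^ s * (-1) ^ (n - 1 - j) * (of_nat (s choose (n - 1 - i)) * fact (n - 1 - i) * fact (n - 1 - j))"
proof -
  let ?f = "\<lambda>t. of_nat (s choose t) * (-1) ^ (s - t) * cnj (moment n (flag_poly n i) t) * moment n (flag_poly n j) (s - t)"
  have "?f t = 0" if "t \<le> s" "t \<noteq> n - 1 - i" for t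
    using flag_moment(1)[OF i, of t] flag_moment(1)[OF j, of "s - t"] s that by (cases "t < n - 1 - i") auto
  then have "(\<Sum>t\<le>s. ?f t) = (\<Sum>t\<in>{n - 1 - i}. ?f t)"
    using s by (intro sum.mono_neutral_right) auto
  also have "\<dots> = of_nat (s choose (n - 1 - i)) * (-1) ^ (n - 1 - j) * fact (n - 1 - i) * fact (n - 1 - j)"
    using flag_moment(2)[OF i] flag_moment(2)[OF j] s by simp
  finally show ?thesis unfolding symbol_form_def power_symbol_form by (simp add: mult_ac)
qed

lemma symbol_form_leading_nonzero:
  assumes "i < n" "j < n" "s = (n - 1 - i) + (n - 1 - j)"
  shows "symbol_form n s i j \<noteq> 0"
  unfolding symbol_form_leading[OF assms] using assms(3) by simp

text \<open>
  The phase \<open>\<i> ^ s\<close> and the sign cancel on the diagonal, so that the value is a positive real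
  number.
\<close>

lemma symbol_form_diagonal:
  assumes "j < n"
  shows "symbol_form n (2 * (n - 1 - j)) j j
    = of_real (real ((2 * (n - 1 - j)) choose (n - 1 - j)) * fact (n - 1 - j) * fact (n - 1 - j))"
  by (subst symbol_form_leading[OF assms assms])
     (auto simp: power_mult power_mult_distrib[symmetric])

lemma coeff_flag_poly:
  shows "a < j \<Longrightarrow> coeff (flag_poly n j) a = 0" and "coeff (flag_poly n j) j = (-1) ^ (n - 1 - j)"
proof -
  have c: "coeff (flag_poly n j) a = (if a < j then 0 else coeff ([:-1, 1:] ^ (n - 1 - j)) (a - j))" for a
    unfolding flag_poly_def by (subst mult.commute) (simp add: coeff_monom_mult)
  show "a < j \<Longrightarrow> coeff (flag_poly n j) a = 0" by (simp add: c)
  show "coeff (flag_poly n j) j = (-1) ^ (n - 1 - j)"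
    unfolding c by (simp add: poly_0_coeff_0[symmetric])
qed

section \<open>Hermitian block Toeplitz matrices\<close>

lemma block_index_less:
  fixes r :: nat
  assumes "r < n * m"
  shows "r div m < n" "r mod m < m"
proof -
  have "m > 0" using assms by (cases m) auto
  then show "r div m < n" "r mod m < m"
    using assms by (auto simp: less_mult_imp_div_less)
qed

lemma sum_div_mod:
  fixes f :: "nat \<Rightarrow> nat \<Rightarrow> 'a :: comm_monoid_add"
  shows "(\<Sum>r<n * m. f (r div m) (r mod m)) = (\<Sum>a<n. \<Sum>b<m. f a b)"
proof -
  have "(\<Sum>r<n * m. f (r div m) (r mod m)) = (\<Sum>a<n. \<Sum>r\<in>{a * m..<a * m + m}. f (r div m) (r mod m))"
    by (rule sum.nat_group[symmetric])
  also have "\<dots> = (\<Sum>a<n. \<Sum>b<m. f a b)"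
  proof (rule sum.cong[OF refl])
    fix a
    have "(\<Sum>r\<in>{a * m..<a * m + m}. f (r div m) (r mod m)) = (\<Sum>b\<in>{0..<m}. f ((b + a * m) div m) ((b + a * m) mod m))"
      using sum.shift_bounds_nat_ivl[of "\<lambda>r. f (r div m) (r mod m)" 0 "a * m" m] by (simp add: add.commute)
    also have "\<dots> = (\<Sum>b<m. f a b)"
      by (intro sum.cong) auto
    finally show "(\<Sum>r\<in>{a * m..<a * m + m}. f (r div m) (r mod m)) = (\<Sum>b<m. f a b)" .
  qed
  finally show ?thesis .
qed

definition hermitian_block_toeplitz :: "nat \<Rightarrow> nat \<Rightarrow> complex mat set" where
  "hermitian_block_toeplitz n m = {T \<in> block_toeplitz n m. hermitian_mat T}"

definition symbol_toeplitz :: "nat \<Rightarrow> nat \<Rightarrow> nat \<Rightarrow> (nat \<Rightarrow> nat \<Rightarrow> complex) \<Rightarrow> complex mat" where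
  "symbol_toeplitz n m s E = block_toeplitz_mat n m (\<lambda>k. mat m m (\<lambda>(i,j). power_symbol s k * E i j))"

text \<open>
  The columns are the coefficient vectors of \<open>flag_poly n j\<close> tensored with the standard basis of
  \<open>\<complex>\<^sup>m\<close>, ordered lexicographically with \<open>j\<close> first.
\<close>

definition toeplitz_flag :: "nat \<Rightarrow> nat \<Rightarrow> complex mat" where
  "toeplitz_flag n m = mat (n * m) (n * m)
     (\<lambda>(r,c). if r mod m = c mod m then coeff (flag_poly n (c div m)) (r div m) else 0)"

lemma block_toeplitz_carrier: "T \<in> block_toeplitz n m \<Longrightarrow> T \<in> carrier_mat (n * m) (n * m)"
  by (auto simp: block_toeplitz_def block_toeplitz_mat_def)

lemma hermitian_block_toeplitz_adjoint:
  "T \<in> hermitian_block_toeplitz n m \<Longrightarrow> mat_adjoint T = T"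
  by (simp add: hermitian_block_toeplitz_def hermitian_mat_def)

lemma symbol_toeplitz_index:
  assumes "r < n * m" "s < n * m"
  shows "symbol_toeplitz n m k E $$ (r,s)
    = power_symbol k (int (r div m) - int (s div m)) * E (r mod m) (s mod m)"
  using assms block_index_less[OF assms(1)] block_index_less[OF assms(2)]
  by (simp add: symbol_toeplitz_def block_toeplitz_mat_def)

lemma hermitian_block_toeplitzI:
  assumes "T \<in> block_toeplitz n m" "\<And>i j. i < n * m \<Longrightarrow> j < n * m \<Longrightarrow> cnj (T $$ (j,i)) = T $$ (i,j)"
  shows "T \<in> hermitian_block_toeplitz n m"
  using assms(1) hermitianI[OF block_toeplitz_carrier[OF assms(1)] assms(2)] block_toeplitz_carrier[OF assms(1)]
  by (auto simp: hermitian_block_toeplitz_def hermitian_mat_def)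

lemma cnj_power_symbol: "cnj (power_symbol s (a - b)) = power_symbol s (b - a)"
  by (simp add: power_symbol_def right_diff_distrib)

lemma symbol_toeplitz_in:
  assumes "\<And>i j. cnj (E j i) = E i j"
  shows "symbol_toeplitz n m s E \<in> hermitian_block_toeplitz n m"
proof (rule hermitian_block_toeplitzI)
  show "symbol_toeplitz n m s E \<in> block_toeplitz n m"
    unfolding symbol_toeplitz_def block_toeplitz_def by auto
  fix i j assume "i < n * m" "j < n * m"
  then show "cnj (symbol_toeplitz n m s E $$ (j,i)) = symbol_toeplitz n m s E $$ (i,j)"
    by (simp add: symbol_toeplitz_index assms cnj_power_symbol)
qed

lemma gram_symbol_toeplitz:
  assumes "i < k" "j < k" "k \<le> n * m"
  shows "gram (n * m) (toeplitz_flag n m) k (symbol_toeplitz n m s E) $$ (i,j)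
    = symbol_form n s (i div m) (j div m) * E (i mod m) (j mod m)"
proof -
  let ?p = "\<lambda>i. flag_poly n (i div m)"
  let ?h = "\<lambda>a a' b b'. (if a' = i mod m then cnj (coeff (?p i) a) else 0) * (power_symbol s (int a - int b) * E a' b')
      * (if b' = j mod m then coeff (?p j) b else 0)"
  have ij: "i < n * m" "j < n * m" using assms by auto
  note mods = block_index_less(2)[OF ij(1)] block_index_less(2)[OF ij(2)]
  have "gram (n * m) (toeplitz_flag n m) k (symbol_toeplitz n m s E) $$ (i,j)
      = (\<Sum>r<n * m. \<Sum>r'<n * m. ?h (r div m) (r mod m) (r' div m) (r' mod m))"
    unfolding gram_index[OF assms(1,2)]
    using ij by (intro sum.cong refl) (simp add: symbol_toeplitz_index toeplitz_flag_def)
  also have "\<dots> = (\<Sum>r<n * m. \<Sum>b<n. \<Sum>b'<m. ?h (r div m) (r mod m) b b')"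
    by (rule sum.cong[OF refl], rule sum_div_mod[where f = "\<lambda>b b'. ?h (r div m) (r mod m) b b'" for r])
  also have "\<dots> = (\<Sum>a<n. \<Sum>a'<m. \<Sum>b<n. \<Sum>b'<m. ?h a a' b b')"
    by (rule sum_div_mod[where f = "\<lambda>a a'. \<Sum>b<n. \<Sum>b'<m. ?h a a' b b'"])
  also have "\<dots> = (\<Sum>a<n. \<Sum>a'<m. \<Sum>b<n. if a' = i mod m then
        cnj (coeff (?p i) a) * (power_symbol s (int a - int b) * E a' (j mod m)) * coeff (?p j) b else 0)"
  proof (intro sum.cong refl)
    fix a a' b
    have "(\<Sum>b'<m. ?h a a' b b') = (\<Sum>b'<m. if b' = j mod m then
        (if a' = i mod m then cnj (coeff (?p i) a) else 0) * (power_symbol s (int a - int b) * E a' (j mod m)) * coeff (?p j) b else 0)"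
      by (intro sum.cong refl) auto
    then show "(\<Sum>b'<m. ?h a a' b b') = (if a' = i mod m then
        cnj (coeff (?p i) a) * (power_symbol s (int a - int b) * E a' (j mod m)) * coeff (?p j) b else 0)"
      using mods by simp
  qed
  also have "\<dots> = (\<Sum>a<n. \<Sum>b<n. cnj (coeff (?p i) a) * (power_symbol s (int a - int b) * E (i mod m) (j mod m)) * coeff (?p j) b)"
  proof (rule sum.cong[OF refl])
    fix a
    let ?k = "\<lambda>a' b. cnj (coeff (?p i) a) * (power_symbol s (int a - int b) * E a' (j mod m)) * coeff (?p j) b"
    have "(\<Sum>a'<m. \<Sum>b<n. if a' = i mod m then ?k a' b else 0) = (\<Sum>a'<m. if a' = i mod m then \<Sum>b<n. ?k a' b else 0)"
      by (intro sum.cong refl) auto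
    then show "(\<Sum>a'<m. \<Sum>b<n. if a' = i mod m then ?k a' b else 0) = (\<Sum>b<n. ?k (i mod m) b)"
      using mods by simp
  qed
  also have "\<dots> = symbol_form n s (i div m) (j div m) * E (i mod m) (j mod m)"
    by (simp add: symbol_form_def sum_distrib_left sum_distrib_right mult_ac)
  finally show ?thesis .
qed

lemma det_toeplitz_flag: "det (toeplitz_flag n m) \<noteq> 0"
proof -
  have C: "toeplitz_flag n m \<in> carrier_mat (n * m) (n * m)" by (simp add: toeplitz_flag_def)
  have "det (toeplitz_flag n m) = prod_list (diag_mat (toeplitz_flag n m))"
  proof (rule det_lower_triangular[OF _ C])
    fix r c assume rc: "r < c" "c < n * m"
    have "r div m < c div m" if "r mod m = c mod m"
    proof -
      have "r div m \<le> c div m" using rc by (simp add: div_le_mono)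
      moreover have "r div m \<noteq> c div m" using that rc by (metis div_mult_mod_eq less_irrefl)
      ultimately show ?thesis by simp
    qed
    then show "toeplitz_flag n m $$ (r,c) = 0" using rc by (simp add: toeplitz_flag_def coeff_flag_poly)
  qed
  also have "\<dots> \<noteq> 0"
    by (auto simp: prod_list_zero_iff diag_mat_def toeplitz_flag_def coeff_flag_poly)
  finally show ?thesis .
qed

text \<open>
  Let \<open>j0\<close> be the block of \<open>k\<close>. The symbol has the order of the pair \<open>(j0, j0)\<close>, so its form vanishes
  on all pairs of blocks up to \<open>j0\<close> except \<open>(j0, j0)\<close>, where the matrix unit \<open>E\<close> selects the entry
  \<open>(k, k)\<close>.
\<close>

lemma toeplitz_corner:
  assumes k: "k < n * m"
  shows "\<exists>D\<in>hermitian_block_toeplitz n m. \<forall>i\<le>k. \<forall>j\<le>k.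
     gram (n * m) (toeplitz_flag n m) (Suc k) D $$ (i,j) = (if i = k \<and> j = k then 1 else 0)"
proof -
  define j0 where "j0 = k div m"
  define s where "s = 2 * (n - 1 - j0)"
  have j0: "j0 < n" using block_index_less[OF k] by (simp add: j0_def)
  define c where "c = real (s choose (n - 1 - j0)) * fact (n - 1 - j0) * fact (n - 1 - j0)"
  have sc: "symbol_form n s j0 j0 = of_real c"
    using symbol_form_diagonal[OF j0] by (simp add: s_def c_def)
  have c: "c \<noteq> 0" by (simp add: c_def s_def)
  define E where "E i j = (if i = k mod m \<and> j = k mod m then complex_of_real (1 / c) else 0)" for i j
  have "gram (n * m) (toeplitz_flag n m) (Suc k) (symbol_toeplitz n m s E) $$ (i,j) = (if i = k \<and> j = k then 1 else 0)"
    if ij: "i \<le> k" "j \<le> k" for i j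
  proof -
    have le: "i div m \<le> j0" "j div m \<le> j0" using ij by (auto simp: j0_def div_le_mono)
    have g: "gram (n * m) (toeplitz_flag n m) (Suc k) (symbol_toeplitz n m s E) $$ (i,j)
        = symbol_form n s (i div m) (j div m) * E (i mod m) (j mod m)"
      by (rule gram_symbol_toeplitz) (use ij k in auto)
    consider "i div m = j0" "j div m = j0" | "i div m < j0 \<or> j div m < j0" using le by linarith
    then show ?thesis
    proof cases
      case 1
      have pos: "l = k" if "l div m = j0" "l mod m = k mod m" for l
        using that unfolding j0_def by (metis div_mult_mod_eq)
      have "i mod m = k mod m \<and> j mod m = k mod m \<longleftrightarrow> i = k \<and> j = k"
        using 1 pos[of i] pos[of j] by auto
      then show ?thesis unfolding g 1 sc E_def using c by simp
    next
      case 2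
      have "symbol_form n s (i div m) (j div m) = 0"
        by (rule symbol_form_zero) (use 2 le j0 in \<open>auto simp: s_def\<close>)
      moreover have "\<not> (i = k \<and> j = k)" using 2 by (auto simp: j0_def)
      ultimately show ?thesis unfolding g by auto
    qed
  qed
  moreover have "symbol_toeplitz n m s E \<in> hermitian_block_toeplitz n m"
    by (rule symbol_toeplitz_in) (simp add: E_def)
  ultimately show ?thesis by blast
qed

text \<open>
  Let \<open>x\<close> and \<open>y\<close> be the blocks of \<open>k\<close> and \<open>k + 1\<close>; either \<open>y = x\<close> or \<open>y = x + 1\<close>. The
  symbol has the order of the pair \<open>(x, y)\<close>. If \<open>x = y\<close> the off-diagonal matrix units in \<open>E\<close> leave
  the entry \<open>(k, k + 1)\<close> and its mirror image. If \<open>x < y\<close> the form vanishes on all pairs of blocks up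
  to \<open>x\<close> and on \<open>(a, y)\<close> for \<open>a < x\<close>, and \<open>E\<close> selects in the block \<open>(x, y)\<close>.
\<close>

lemma toeplitz_off_corner:
  assumes k: "Suc k < n * m"
  shows "\<exists>F\<in>hermitian_block_toeplitz n m.
     (\<forall>i\<le>k. \<forall>j\<le>k. gram (n * m) (toeplitz_flag n m) (Suc (Suc k)) F $$ (i,j) = 0)
     \<and> (\<forall>i<k. gram (n * m) (toeplitz_flag n m) (Suc (Suc k)) F $$ (i, Suc k) = 0)
     \<and> gram (n * m) (toeplitz_flag n m) (Suc (Suc k)) F $$ (k, Suc k) \<noteq> 0"
proof -
  define x where "x = k div m"
  define y where "y = Suc k div m"
  define s where "s = (n - 1 - x) + (n - 1 - y)"
  have k': "k < n * m" using k by simp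
  have m: "m > 0" using k by (cases m) auto
  have x: "x < n" and y: "y < n" using block_index_less[OF k] block_index_less[OF k'] by (auto simp: x_def y_def)
  have xy: "x \<le> y" by (simp add: x_def y_def div_le_mono)
  define E where "E i j = (if (i = k mod m \<and> j = Suc k mod m) \<or> (i = Suc k mod m \<and> j = k mod m) then 1 else (0::complex))" for i j
  let ?F = "symbol_toeplitz n m s E"
  have g: "gram (n * m) (toeplitz_flag n m) (Suc (Suc k)) ?F $$ (i,j)
      = symbol_form n s (i div m) (j div m) * E (i mod m) (j mod m)" if "i \<le> Suc k" "j \<le> Suc k" for i j
    by (rule gram_symbol_toeplitz) (use that k in auto)
  have zero: "symbol_form n s a b = 0" if "a \<le> x" "b \<le> x" "a < x \<or> b < x \<or> x < y" for a b
    by (rule symbol_form_zero) (use that x y xy in \<open>auto simp: s_def\<close>)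
  have zero': "symbol_form n s a y = 0" if "a < x" for a
    by (rule symbol_form_zero) (use that x y in \<open>auto simp: s_def\<close>)
  have pos: "i = k" if "i div m = x" "i mod m = k mod m" for i
    using that unfolding x_def by (metis div_mult_mod_eq)
  have pos': "i = Suc k" if "i div m = y" "i mod m = Suc k mod m" for i
    using that unfolding y_def by (metis div_mult_mod_eq)
  have 1: "gram (n * m) (toeplitz_flag n m) (Suc (Suc k)) ?F $$ (i,j) = 0" if ij: "i \<le> k" "j \<le> k" for i j
  proof -
    have le: "i div m \<le> x" "j div m \<le> x" using ij by (auto simp: x_def div_le_mono)
    show ?thesis
    proof (cases "i div m < x \<or> j div m < x \<or> x < y")
      case True
      then show ?thesis using g[of i j] zero[OF le] ij by simp
    next
      case False
      then have "i div m = y" "j div m = y" using le xy by auto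
      then have "E (i mod m) (j mod m) = 0" using pos'[of i] pos'[of j] ij by (auto simp: E_def)
      then show ?thesis using g[of i j] ij by simp
    qed
  qed
  have 2: "gram (n * m) (toeplitz_flag n m) (Suc (Suc k)) ?F $$ (i, Suc k) = 0" if i: "i < k" for i
  proof (cases "i div m < x")
    case True
    then show ?thesis using g[of i "Suc k"] zero'[OF True] i by (simp add: y_def)
  next
    case False
    have "i div m \<le> x" using i by (simp add: x_def div_le_mono)
    then have ix: "i div m = x" using False by simp
    have "E (i mod m) (Suc k mod m) = 0"
    proof -
      have ne: "i mod m \<noteq> k mod m" using pos[OF ix] i by auto
      have "\<not> (i mod m = Suc k mod m \<and> Suc k mod m = k mod m)" using ne by auto
      then show ?thesis using ne by (simp add: E_def)
    qed
    then show ?thesis using g[of i "Suc k"] i by simp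
  qed
  have "symbol_form n s x y \<noteq> 0" by (rule symbol_form_leading_nonzero[OF x y s_def])
  then have 3: "gram (n * m) (toeplitz_flag n m) (Suc (Suc k)) ?F $$ (k, Suc k) \<noteq> 0"
    using g[of k "Suc k"] by (simp add: x_def y_def E_def)
  have "?F \<in> hermitian_block_toeplitz n m" by (rule symbol_toeplitz_in) (auto simp: E_def)
  then show ?thesis using 1 2 3 by blast
qed

lemma block_toeplitz_add_smult:
  assumes "A \<in> block_toeplitz n m" "B \<in> block_toeplitz n m"
  shows "A + x \<cdot>\<^sub>m B \<in> block_toeplitz n m"
proof -
  obtain S T where S: "A = block_toeplitz_mat n m S" "\<forall>k \<in> {- int n + 1 .. int n - 1}. S k \<in> carrier_mat m m"
    and T: "B = block_toeplitz_mat n m T" "\<forall>k \<in> {- int n + 1 .. int n - 1}. T k \<in> carrier_mat m m"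
    using assms unfolding block_toeplitz_def by blast
  have "A + x \<cdot>\<^sub>m B = block_toeplitz_mat n m (\<lambda>k. S k + x \<cdot>\<^sub>m T k)"
  proof (rule eq_matI)
    fix r c assume "r < dim_row (block_toeplitz_mat n m (\<lambda>k. S k + x \<cdot>\<^sub>m T k))"
      "c < dim_col (block_toeplitz_mat n m (\<lambda>k. S k + x \<cdot>\<^sub>m T k))"
    then have rc: "r < n * m" "c < n * m" by (auto simp: block_toeplitz_mat_def)
    note b = block_index_less[OF rc(1)] block_index_less[OF rc(2)]
    have "int (r div m) - int (c div m) \<in> {- int n + 1 .. int n - 1}" using b(1,3) by auto
    then have "T (int (r div m) - int (c div m)) \<in> carrier_mat m m" using T(2) by blast
    then show "(A + x \<cdot>\<^sub>m B) $$ (r,c) = block_toeplitz_mat n m (\<lambda>k. S k + x \<cdot>\<^sub>m T k) $$ (r,c)"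
      using rc b by (simp add: S(1) T(1) block_toeplitz_mat_def)
  qed (auto simp: S(1) T(1) block_toeplitz_mat_def)
  moreover have "\<forall>k \<in> {- int n + 1 .. int n - 1}. S k + x \<cdot>\<^sub>m T k \<in> carrier_mat m m"
    using S(2) T(2) by auto
  ultimately show ?thesis unfolding block_toeplitz_def by blast
qed

interpretation toeplitz: flagged_hermitian_space "n * m" "toeplitz_flag n m" "hermitian_block_toeplitz n m"
  for n m
proof
  show "hermitian_block_toeplitz n m \<subseteq> carrier_mat (n * m) (n * m)"
    using block_toeplitz_carrier by (auto simp: hermitian_block_toeplitz_def)
  show "mat_adjoint A = A" if "A \<in> hermitian_block_toeplitz n m" for A
    using that by (rule hermitian_block_toeplitz_adjoint)
  show "0\<^sub>m (n * m) (n * m) \<in> hermitian_block_toeplitz n m"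
  proof -
    have "symbol_toeplitz n m 0 (\<lambda>_ _. 0) = 0\<^sub>m (n * m) (n * m)"
      by (rule eq_matI) (auto simp: symbol_toeplitz_index, auto simp: symbol_toeplitz_def block_toeplitz_mat_def)
    then show ?thesis using symbol_toeplitz_in[of "\<lambda>_ _. 0" n m 0] by simp
  qed
  show "A + complex_of_real x \<cdot>\<^sub>m B \<in> hermitian_block_toeplitz n m"
    if A: "A \<in> hermitian_block_toeplitz n m" and B: "B \<in> hermitian_block_toeplitz n m" for A B x
  proof (rule hermitian_block_toeplitzI)
    have AB: "A \<in> block_toeplitz n m" "B \<in> block_toeplitz n m"
      using A B by (auto simp: hermitian_block_toeplitz_def)
    then show "A + complex_of_real x \<cdot>\<^sub>m B \<in> block_toeplitz n m" by (rule block_toeplitz_add_smult)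
    note c = block_toeplitz_carrier[OF AB(1)] block_toeplitz_carrier[OF AB(2)]
    fix i j assume ij: "i < n * m" "j < n * m"
    show "cnj ((A + complex_of_real x \<cdot>\<^sub>m B) $$ (j,i)) = (A + complex_of_real x \<cdot>\<^sub>m B) $$ (i,j)"
      using c ij hermitian_index[OF c(1) hermitian_block_toeplitz_adjoint[OF A] ij]
        hermitian_index[OF c(2) hermitian_block_toeplitz_adjoint[OF B] ij] by simp
  qed
qed (use toeplitz_corner toeplitz_off_corner in blast)+

lemma H_toeplitz_eq: "H_toeplitz n m = {T \<in> hermitian_block_toeplitz n m. det T \<noteq> 0}"
  using invertible_mat_iff_det[OF block_toeplitz_carrier]
  by (auto simp: H_toeplitz_def hermitian_block_toeplitz_def)

lemma H_toeplitz_sig_eq: "H_toeplitz_sig n m p q = toeplitz.S n m (n * m) p q"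
proof -
  have C: "toeplitz_flag n m \<in> carrier_mat (n * m) (n * m)" by (simp add: toeplitz_flag_def)
  have "has_inertia (n * m) p q (gram (n * m) (toeplitz_flag n m) (n * m) T)
      \<longleftrightarrow> det T \<noteq> 0 \<and> num_pos_eigenvalues T = p \<and> num_neg_eigenvalues T = q"
    if T: "T \<in> hermitian_block_toeplitz n m" for T
    unfolding has_inertia_congruence[OF C det_toeplitz_flag toeplitz.L_carrier[OF T] hermitian_block_toeplitz_adjoint[OF T]]
    using toeplitz.L_carrier[OF T] hermitian_block_toeplitz_adjoint[OF T] by (simp add: has_inertia_def)
  then show ?thesis
    unfolding H_toeplitz_sig_def H_toeplitz_eq toeplitz.S_def by blast
qed

lemma H_toeplitz_inertia:
  assumes "T \<in> H_toeplitz n m"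
  shows "has_inertia (n * m) (num_pos_eigenvalues T) (num_neg_eigenvalues T) T"
  using assms toeplitz.L_carrier hermitian_block_toeplitz_adjoint by (auto simp: H_toeplitz_eq has_inertia_def)

lemma joined_mono: "joined N S A B \<Longrightarrow> S \<subseteq> T \<Longrightarrow> joined N T A B"
  unfolding joined_def path_component_of_def pathin_subtopology by blast

lemma path_component_H_toeplitz:
  assumes T: "T \<in> H_toeplitz_sig n m p q"
  shows "{T'. joined (n * m) (H_toeplitz n m) T T'} = H_toeplitz_sig n m p q"
proof (intro equalityI subsetI)
  fix T' assume "T' \<in> H_toeplitz_sig n m p q"
  then have "joined (n * m) (H_toeplitz_sig n m p q) T T'"
    using T toeplitz.S_joined[of "n * m" n m T p q T'] by (simp add: H_toeplitz_sig_eq)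
  then show "T' \<in> {T'. joined (n * m) (H_toeplitz n m) T T'}"
    by (auto simp: H_toeplitz_sig_def elim!: joined_mono)
next
  fix T' assume "T' \<in> {T'. joined (n * m) (H_toeplitz n m) T T'}"
  then have j: "joined (n * m) (H_toeplitz n m) T T'" by simp
  obtain g :: "real \<Rightarrow> complex mat" where g: "\<And>t. t \<in> {0..1} \<Longrightarrow> g t \<in> H_toeplitz n m" "g 0 = T" "g 1 = T'"
    "\<And>i j. i < n * m \<Longrightarrow> j < n * m \<Longrightarrow> continuous_on {0..1} (\<lambda>t. g t $$ (i,j))"
    by (rule joinedE[OF j]) (rule that)
  have h: "g t \<in> carrier_mat (n * m) (n * m)" "mat_adjoint (g t) = g t" "det (g t) \<noteq> 0" if "t \<in> {0..1}" for t
    using g(1)[OF that] H_toeplitz_inertia by (auto simp: has_inertia_def)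
  have "has_inertia (n * m) p q (g 0)"
    using H_toeplitz_inertia[of T n m] T g(2) by (simp add: H_toeplitz_sig_def)
  then have "has_inertia (n * m) p q (g 1)"
    by (intro has_inertia_along_path[where M = g and a = 0 and b = 1 and s = 0 and t = 1, OF g(4) h]) auto
  then show "T' \<in> H_toeplitz_sig n m p q"
    using joined_in(2)[OF j] g(3) by (simp add: H_toeplitz_sig_def has_inertia_def)
qed

lemma H_toeplitz_sig_nonempty: "p + q = n * m \<Longrightarrow> H_toeplitz_sig n m p q \<noteq> {}"
  using toeplitz.S_nonempty[of "n * m" n m p q] by (simp add: H_toeplitz_sig_eq)

lemma V0_toeplitz_eq: "V0_toeplitz n m = (\<lambda>(p, q). H_toeplitz_sig n m p q) ` {(p, q). p + q = n * m}"
proof -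
  let ?X = "subtopology (mat_topology (n * m)) (H_toeplitz n m)"
  have top: "topspace ?X = H_toeplitz n m"
    using toeplitz.L_carrier by (auto simp: topspace_mat_topology H_toeplitz_eq)
  have comp: "Collect (path_component_of ?X T) = H_toeplitz_sig n m p q" if "T \<in> H_toeplitz_sig n m p q" for T p q
    using path_component_H_toeplitz[OF that] unfolding joined_def .
  show ?thesis
    unfolding V0_toeplitz_def path_components_of_def top
  proof (intro equalityI subsetI)
    fix K assume "K \<in> (\<lambda>T. Collect (path_component_of ?X T)) ` H_toeplitz n m"
    then obtain T where T: "T \<in> H_toeplitz n m" "K = Collect (path_component_of ?X T)" by blast
    let ?p = "num_pos_eigenvalues T" and ?q = "num_neg_eigenvalues T"
    have "?p + ?q = n * m" using has_inertia_sum[OF H_toeplitz_inertia[OF T(1)]] .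
    moreover have "K = H_toeplitz_sig n m ?p ?q"
      unfolding T(2) by (rule comp) (use T in \<open>simp add: H_toeplitz_sig_def\<close>)
    ultimately show "K \<in> (\<lambda>(p, q). H_toeplitz_sig n m p q) ` {(p, q). p + q = n * m}" by auto
  next
    fix K assume "K \<in> (\<lambda>(p, q). H_toeplitz_sig n m p q) ` {(p, q). p + q = n * m}"
    then obtain p q where pq: "p + q = n * m" "K = H_toeplitz_sig n m p q" by auto
    then obtain T where T: "T \<in> H_toeplitz_sig n m p q" using H_toeplitz_sig_nonempty by blast
    then have "T \<in> H_toeplitz n m" by (simp add: H_toeplitz_sig_def)
    then show "K \<in> (\<lambda>T. Collect (path_component_of ?X T)) ` H_toeplitz n m"
      using comp[OF T] pq by blast
  qed
qed

lemma signature_label_image: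
  assumes "p + q = n * m"
  shows "signature_label ` H_toeplitz_sig n m p q = {int p - int q}"
  using H_toeplitz_sig_nonempty[OF assms] by (auto simp: H_toeplitz_sig_def signature_label_def)

theorem theorem3p1:
  fixes n m :: nat
  assumes "n \<ge> 1" and "m \<ge> 1"
  shows "(\<forall>p q. p + q = n * m \<longrightarrow>
             path_connectedin (mat_topology (n * m)) (H_toeplitz_sig n m p q))
       \<and> card (V0_toeplitz n m) = n * m + 1
       \<and> bij_betw (\<lambda>(p, q). H_toeplitz_sig n m p q) {(p, q). p + q = n * m} (V0_toeplitz n m)
       \<and> (\<forall>C \<in> V0_toeplitz n m. \<forall>S \<in> C. \<forall>T \<in> C. signature_label S = signature_label T)
       \<and> bij_betw (\<lambda>C. the_elem (signature_label ` C)) (V0_toeplitz n m)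
           {- int (n * m) + 2 * int k | k. k \<le> n * m}"
proof (intro conjI)
  let ?P = "{(p, q). p + q = n * m}"
  let ?H = "\<lambda>(p, q). H_toeplitz_sig n m p q"
  show "\<forall>p q. p + q = n * m \<longrightarrow> path_connectedin (mat_topology (n * m)) (H_toeplitz_sig n m p q)"
  proof (intro allI impI)
    fix p q assume "p + q = n * m"
    have sub: "H_toeplitz_sig n m p q \<subseteq> carrier_mat (n * m) (n * m)"
      using toeplitz.S_carrier by (simp add: H_toeplitz_sig_eq)
    have "\<exists>g. pathin (subtopology (mat_topology (n * m)) (H_toeplitz_sig n m p q)) g \<and> g 0 = A \<and> g 1 = B"
      if "A \<in> H_toeplitz_sig n m p q" "B \<in> H_toeplitz_sig n m p q" for A B
      using toeplitz.S_joined[of "n * m" n m A p q B] that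
      by (simp add: H_toeplitz_sig_eq joined_def path_component_of_def)
    then show "path_connectedin (mat_topology (n * m)) (H_toeplitz_sig n m p q)"
      using sub unfolding path_connectedin_def path_connected_space_def
      by (auto simp: topspace_mat_topology)
  qed
  have inj: "inj_on ?H ?P"
  proof (rule inj_onI, clarify)
    fix p q p' q' assume pq: "p + q = n * m" "p' + q' = n * m"
      and e: "H_toeplitz_sig n m p q = H_toeplitz_sig n m p' q'"
    obtain T where "T \<in> H_toeplitz_sig n m p q" using H_toeplitz_sig_nonempty[OF pq(1)] by blast
    moreover from this have "T \<in> H_toeplitz_sig n m p' q'" using e by simp
    ultimately show "p = p' \<and> q = q'" by (simp add: H_toeplitz_sig_def)
  qed
  show bij: "bij_betw ?H ?P (V0_toeplitz n m)"
    unfolding bij_betw_def V0_toeplitz_eq using inj by simp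
  have "bij_betw (\<lambda>p. (p, n * m - p)) {..n * m} ?P"
    by (rule bij_betwI[where g = fst]) auto
  then have "card ?P = card {..n * m}" by (rule bij_betw_same_card[symmetric])
  then show "card (V0_toeplitz n m) = n * m + 1"
    using bij_betw_same_card[OF bij] by simp
  show "\<forall>C \<in> V0_toeplitz n m. \<forall>S \<in> C. \<forall>T \<in> C. signature_label S = signature_label T"
    unfolding V0_toeplitz_eq by (auto simp: H_toeplitz_sig_def signature_label_def)
  have "bij_betw (\<lambda>(p, q). int p - int q) ?P {- int (n * m) + 2 * int k | k. k \<le> n * m}"
  proof (rule bij_betw_imageI)
    show "inj_on (\<lambda>(p, q). int p - int q) ?P" by (auto simp: inj_on_def)
    show "(\<lambda>(p, q). int p - int q) ` ?P = {- int (n * m) + 2 * int k | k. k \<le> n * m}"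
    proof (intro equalityI subsetI)
      fix x assume "x \<in> (\<lambda>(p, q). int p - int q) ` ?P"
      then obtain p q where "p + q = n * m" "x = int p - int q" by auto
      then have "x = - int (n * m) + 2 * int p" "p \<le> n * m" by linarith+
      then show "x \<in> {- int (n * m) + 2 * int k | k. k \<le> n * m}" by blast
    next
      fix x assume "x \<in> {- int (n * m) + 2 * int k | k. k \<le> n * m}"
      then obtain k where k: "k \<le> n * m" "x = - int (n * m) + 2 * int k" by blast
      then have "(k, n * m - k) \<in> ?P" "x = int k - int (n * m - k)" by auto
      then show "x \<in> (\<lambda>(p, q). int p - int q) ` ?P" by force
    qed
  qed
  moreover have "the_elem (signature_label ` ?H pq) = (\<lambda>(p, q). int p - int q) pq" if "pq \<in> ?P" for pq
    using that by (auto simp: signature_label_image)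
  ultimately have "bij_betw ((\<lambda>C. the_elem (signature_label ` C)) \<circ> ?H) ?P {- int (n * m) + 2 * int k | k. k \<le> n * m}"
    by (subst bij_betw_cong[where g = "\<lambda>(p, q). int p - int q"]) auto
  then show "bij_betw (\<lambda>C. the_elem (signature_label ` C)) (V0_toeplitz n m)
           {- int (n * m) + 2 * int k | k. k \<le> n * m}"
    using bij_betw_comp_iff[OF bij] by blast
qed

end
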